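(* Let $n>1$ be an integer. Suppose that $G$ is a finite soluble group and that each $n$-maximal subgroup of $G$ is $S$-quasinormal in $G$. Then $r(G)\leq n-1$.
   Context: All groups are finite. If $M_n<M_{n-1}<\cdots<M_1<M_0=G$ with $M_i$ a maximal subgroup of $M_{i-1}$ for all $i=1,\ldots,n$, then $M_n$ is called an $n$-maximal subgroup of $G$. A subgroup $H$ of $G$ is $S$-quasinormal in $G$ if $HP=PH$ for every Sylow subgroup $P$ of $G$. The rank $r(G)$ of a soluble group $G$ is the maximal integer $k$ such that $G$ has a chief factor of order $p^k$ for some prime $p$. *)

theory Defs
  imports "HOL-Algebra.Solvable_Groups" "HOL-Algebra.Sylow"
begin

definition maximal_subgroup :: "'a set \<Rightarrow> ('a, 'b) monoid_scheme \<Rightarrow> bool" where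
  "maximal_subgroup M G \<longleftrightarrow>
     subgroup M G \<and> M \<noteq> carrier G \<and>
     (\<forall>L. subgroup L G \<and> M \<subseteq> L \<longrightarrow> L = M \<or> L = carrier G)"

definition n_maximal_subgroup :: "nat \<Rightarrow> 'a set \<Rightarrow> ('a, 'b) monoid_scheme \<Rightarrow> bool" where
  "n_maximal_subgroup n H G \<longleftrightarrow>
     (\<exists>M :: nat \<Rightarrow> 'a set.
        M 0 = carrier G \<and> M n = H \<and>
        (\<forall>i<n. maximal_subgroup (M (Suc i)) (G\<lparr>carrier := M i\<rparr>)))"

(* Primes not dividing the order of G are admitted; they only contribute the
   trivial subgroup, which permutes with every subgroup. *)
definition sylow_subgroup :: "'a set \<Rightarrow> ('a, 'b) monoid_scheme \<Rightarrow> bool" where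
  "sylow_subgroup P G \<longleftrightarrow>
     subgroup P G \<and> (\<exists>p::nat. prime p \<and> card P = p ^ multiplicity p (order G))"

definition S_quasinormal :: "'a set \<Rightarrow> ('a, 'b) monoid_scheme \<Rightarrow> bool" where
  "S_quasinormal H G \<longleftrightarrow>
     subgroup H G \<and> (\<forall>P. sylow_subgroup P G \<longrightarrow> H <#>\<^bsub>G\<^esub> P = P <#>\<^bsub>G\<^esub> H)"

(* chief_factor G H K: the section H/K is a chief factor of G. *)
definition chief_factor :: "('a, 'b) monoid_scheme \<Rightarrow> 'a set \<Rightarrow> 'a set \<Rightarrow> bool" where
  "chief_factor G H K \<longleftrightarrow>
     H \<lhd> G \<and> K \<lhd> G \<and> K \<subset> H \<and>
     (\<forall>N. N \<lhd> G \<and> K \<subseteq> N \<and> N \<subseteq> H \<longrightarrow> N = K \<or> N = H)"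

(* For finite G the set of exponents is finite, so Sup is its maximum, except that
   the set is empty if G is trivial: then the rank is 0, since Sup {} = 0 on nat. *)
definition chief_rank :: "('a, 'b) monoid_scheme \<Rightarrow> nat" where
  "chief_rank G =
     Sup {k. \<exists>p H K. prime (p::nat) \<and> chief_factor G H K \<and>
                     order (G\<lparr>carrier := H\<rparr> Mod K) = p ^ k}"

end

theory Submission
  imports Defs
begin

text \<open>
  Suppose a chief factor \<open>H/K\<close> has order \<open>p\<^sup>k\<close> with \<open>k \<ge> n\<close>, and let \<open>P\<close> be a Sylow \<open>p\<close>-subgroup. Since
  \<open>P\<close> is a \<open>p\<close>-group, there is a chain \<open>H = A\<^sub>0 > A\<^sub>1 > \<dots> > A\<^sub>k = K\<close> of \<open>P\<close>-invariant subgroups, each of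
  index \<open>p\<close> in the previous one. If some \<open>S\<close>-quasinormal \<open>X\<close> has \<open>X \<inter> H = A\<^sub>i\<close> with \<open>0 < i < k\<close>, then for
  every prime \<open>r \<noteq> p\<close> and Sylow \<open>r\<close>-subgroup \<open>R\<close> an index comparison gives \<open>XR \<inter> H = X \<inter> H\<close>, so \<open>R\<close>
  normalizes \<open>A\<^sub>i\<close>; hence \<open>A\<^sub>i\<close> is normal in \<open>G\<close>, a contradiction. The same contradiction shows that
  some Sylow \<open>q\<close>-subgroup \<open>Q\<close> with \<open>q \<noteq> p\<close> acts nontrivially on \<open>H/K\<close>.

  It remains to find an \<open>n\<close>-maximal \<open>X\<close> of this kind. Take a maximal chain from \<open>G\<close> through \<open>HQ\<close> to \<open>H\<close>,
  of length \<open>l \<ge> 1\<close>. If \<open>l < n\<close>, then \<open>X = A\<^bsub>n-l\<^esub>\<close> works. Otherwise let \<open>W\<close> be the \<open>(n-1)\<close>-maximal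
  member of the chain. All its maximal subgroups are \<open>S\<close>-quasinormal in \<open>G\<close>, so a Frattini argument
  makes \<open>Q \<inter> W\<close> normal in \<open>W\<close>. If \<open>W\<close> contains \<open>HQ\<close>, this forces \<open>[H, Q] \<le> H \<inter> Q \<le> K\<close>, contrary to the
  choice of \<open>Q\<close>. If \<open>H \<le> W \<le> HQ\<close>, then \<open>X = A\<^sub>1(Q \<inter> W)\<close> is maximal in \<open>W\<close> and \<open>X \<inter> H = A\<^sub>1\<close>.
\<close>

subsection \<open>Products of subgroups and fixed points of \<open>p\<close>-groups\<close>

text \<open>Counting by fibres of constant size. This form serves the product formula, the
  orbit-stabilizer count and the coset counts below.\<close>

lemma card_eq_card_image_mult:
  assumes "finite A" "\<And>a. a \<in> A \<Longrightarrow> card {x \<in> A. f x = f a} = c"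
  shows "card A = card (f ` A) * c"
proof -
  have "card A = (\<Sum>y\<in>f ` A. card {x \<in> A. f x = y})"
    using sum.image_gen[OF assms(1), of "\<lambda>_. 1::nat" f] by simp
  also have "\<dots> = (\<Sum>y\<in>f ` A. c)"
    using assms(2) by (intro sum.cong) auto
  finally show ?thesis by simp
qed

context group
begin

text \<open>For finite \<open>A\<close> the one-sided condition suffices: conjugation is injective,
  so mapping \<open>A\<close> into itself forces equality, and this is the usual normalizer.\<close>

definition setnormalizer :: "'a set \<Rightarrow> 'a set" where
  "setnormalizer A = {g \<in> carrier G. \<forall>a\<in>A. g \<otimes> a \<otimes> inv g \<in> A}"

lemma inv_mult_cancel [simp]:
  "x \<in> carrier G \<Longrightarrow> y \<in> carrier G \<Longrightarrow> inv x \<otimes> (x \<otimes> y) = y"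
  "x \<in> carrier G \<Longrightarrow> y \<in> carrier G \<Longrightarrow> x \<otimes> (inv x \<otimes> y) = y"
  by (simp_all flip: m_assoc)

lemma setnormalizer_subgroup:
  assumes "A \<subseteq> carrier G" "finite A"
  shows "subgroup (setnormalizer A) G"
proof (rule subgroupI)
  show "setnormalizer A \<subseteq> carrier G" by (auto simp: setnormalizer_def)
  have "\<one> \<in> setnormalizer A" using assms by (auto simp: setnormalizer_def)
  then show "setnormalizer A \<noteq> {}" by auto
next
  fix g assume g: "g \<in> setnormalizer A"
  then have gc: "g \<in> carrier G" by (simp add: setnormalizer_def)
  have "inj_on (\<lambda>a. g \<otimes> a \<otimes> inv g) A"
    using assms(1) gc by (intro inj_onI) (simp add: subset_iff)
  moreover have "(\<lambda>a. g \<otimes> a \<otimes> inv g) ` A \<subseteq> A" using g by (auto simp: setnormalizer_def)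
  ultimately have eq: "(\<lambda>a. g \<otimes> a \<otimes> inv g) ` A = A"
    using assms(2) by (simp add: endo_inj_surj)
  have "inv g \<otimes> a \<otimes> inv (inv g) \<in> A" if "a \<in> A" for a
  proof -
    from that eq obtain b where b: "b \<in> A" "a = g \<otimes> b \<otimes> inv g" by blast
    then have "inv g \<otimes> a \<otimes> inv (inv g) = b"
      using gc assms(1) by (simp add: m_assoc subset_iff)
    then show ?thesis using b by simp
  qed
  then show "inv g \<in> setnormalizer A" using gc by (simp add: setnormalizer_def)
next
  fix g h assume gh: "g \<in> setnormalizer A" "h \<in> setnormalizer A"
  then have c: "g \<in> carrier G" "h \<in> carrier G" by (simp_all add: setnormalizer_def)
  have "g \<otimes> h \<otimes> a \<otimes> inv (g \<otimes> h) \<in> A" if "a \<in> A" for a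
  proof -
    have "g \<otimes> h \<otimes> a \<otimes> inv (g \<otimes> h) = g \<otimes> (h \<otimes> a \<otimes> inv h) \<otimes> inv g"
      using c that assms(1) by (simp add: m_assoc inv_mult_group subset_iff)
    then show ?thesis using gh that by (simp add: setnormalizer_def)
  qed
  then show "g \<otimes> h \<in> setnormalizer A" using c by (simp add: setnormalizer_def)
qed

lemma subgroup_subset_setnormalizer:
  assumes "subgroup A G"
  shows "A \<subseteq> setnormalizer A"
  by (auto simp: setnormalizer_def subgroup.mem_carrier[OF assms] subgroup.m_closed[OF assms]
      subgroup.m_inv_closed[OF assms])

lemma normal_iff_setnormalizer:
  "N \<lhd> G \<longleftrightarrow> subgroup N G \<and> setnormalizer N = carrier G"
  by (auto simp: normal_inv_iff setnormalizer_def)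

section \<open>Products of two subgroups\<close>

lemma set_mult_iff: "z \<in> X <#> Y \<longleftrightarrow> (\<exists>x\<in>X. \<exists>y\<in>Y. z = x \<otimes> y)"
  by (auto simp: set_mult_def)

lemma left_subset_set_mult:
  assumes "subgroup X G" "subgroup Y G"
  shows "X \<subseteq> X <#> Y"
proof
  fix x assume "x \<in> X"
  then have "x = x \<otimes> \<one>" using assms by (simp add: subgroup.mem_carrier)
  then show "x \<in> X <#> Y" using \<open>x \<in> X\<close> subgroup.one_closed[OF assms(2)] by (auto simp: set_mult_iff)
qed

lemma right_subset_set_mult:
  assumes "subgroup X G" "subgroup Y G"
  shows "Y \<subseteq> X <#> Y"
proof
  fix y assume "y \<in> Y"
  then have "y = \<one> \<otimes> y" using assms by (simp add: subgroup.mem_carrier)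
  then show "y \<in> X <#> Y" using \<open>y \<in> Y\<close> subgroup.one_closed[OF assms(1)] by (auto simp: set_mult_iff)
qed

lemma set_mult_subset_subgroup:
  assumes "subgroup Z G" "X \<subseteq> Z" "Y \<subseteq> Z"
  shows "X <#> Y \<subseteq> Z"
  using assms by (auto simp: set_mult_iff subgroup.m_closed subset_iff)

lemma subgroup_set_mult:
  assumes X: "subgroup X G" and Y: "subgroup Y G" and comm: "X <#> Y = Y <#> X"
  shows "subgroup (X <#> Y) G"
proof (rule subgroupI)
  note XY = subgroup.mem_carrier[OF X] subgroup.mem_carrier[OF Y]
  show "X <#> Y \<subseteq> carrier G"
    using X Y by (meson setmult_subset_G subgroup.subset)
  show "X <#> Y \<noteq> {}"
    using left_subset_set_mult[OF X Y] subgroup.one_closed[OF X] by auto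
  show "inv z \<in> X <#> Y" if "z \<in> X <#> Y" for z
  proof -
    from that obtain x y where "x \<in> X" "y \<in> Y" "z = x \<otimes> y" by (auto simp: set_mult_iff)
    then have "inv z = inv y \<otimes> inv x" "inv y \<in> Y" "inv x \<in> X"
      using XY X Y by (simp_all add: inv_mult_group subgroup.m_inv_closed)
    then show ?thesis by (auto simp: comm set_mult_iff)
  qed
  show "z \<otimes> w \<in> X <#> Y" if "z \<in> X <#> Y" "w \<in> X <#> Y" for z w
  proof -
    from that obtain x y where 1: "x \<in> X" "y \<in> Y" "z = x \<otimes> y" by (auto simp: set_mult_iff)
    \<comment> \<open>Splitting \<open>w\<close> in the opposite order puts the two factors from
      \<open>Y\<close> side by side. What follows \<open>x\<close> in the product then lies in
      \<open>Y <#> X\<close> and can be split again in the order \<open>X\<close>,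
      \<open>Y\<close>.\<close>
    from that obtain y' x' where 2: "x' \<in> X" "y' \<in> Y" "w = y' \<otimes> x'" by (auto simp: comm set_mult_iff)
    have "(y \<otimes> y') \<otimes> x' \<in> X <#> Y"
      using 1 2 Y subgroup.m_closed by (fastforce simp: comm set_mult_iff)
    then obtain x'' y'' where 3: "x'' \<in> X" "y'' \<in> Y" "(y \<otimes> y') \<otimes> x' = x'' \<otimes> y''"
      by (auto simp: set_mult_iff)
    have "z \<otimes> w = x \<otimes> ((y \<otimes> y') \<otimes> x')" using 1 2 XY by (simp add: m_assoc)
    also have "\<dots> = (x \<otimes> x'') \<otimes> y''" unfolding 3(3) using 1 3 XY by (simp add: m_assoc)
    finally show ?thesis using 1 3 X subgroup.m_closed by (fastforce simp: set_mult_iff)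
  qed
qed

lemma set_mult_commute_if_setnormalizer:
  assumes X: "subgroup X G" and Y: "subgroup Y G" and n: "X \<subseteq> setnormalizer Y"
  shows "X <#> Y = Y <#> X"
proof -
  note XY = subgroup.mem_carrier[OF X] subgroup.mem_carrier[OF Y]
  have "x \<otimes> y \<in> Y <#> X" if "x \<in> X" "y \<in> Y" for x y
  proof -
    have "x \<otimes> y = (x \<otimes> y \<otimes> inv x) \<otimes> x" using that XY by (simp add: m_assoc)
    then show ?thesis using n that by (auto simp: setnormalizer_def set_mult_iff)
  qed
  moreover have "y \<otimes> x \<in> X <#> Y" if "x \<in> X" "y \<in> Y" for x y
  proof -
    have "y \<otimes> x = x \<otimes> (inv x \<otimes> y \<otimes> inv (inv x))" using that XY by (simp add: m_assoc)
    moreover have "inv x \<in> setnormalizer Y" using n subgroup.m_inv_closed[OF X that(1)] by auto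
    ultimately show ?thesis using that by (auto simp: setnormalizer_def set_mult_iff simp del: inv_inv)
  qed
  ultimately show ?thesis by (auto simp: set_mult_iff)
qed

text \<open>The fibre of multiplication through \<open>(a, b)\<close> consists of the pairs
  \<open>(a d, d^-1 b)\<close> with \<open>d\<close> in the intersection, so all fibres have the
  same size.\<close>

lemma card_set_mult:
  assumes X: "subgroup X G" and Y: "subgroup Y G" and fin: "finite X" "finite Y"
  shows "card (X <#> Y) * card (X \<inter> Y) = card X * card Y"
proof -
  note XY = subgroup.mem_carrier[OF X] subgroup.mem_carrier[OF Y]
  let ?f = "\<lambda>(x, y). x \<otimes> y"
  have "card (X \<times> Y) = card (?f ` (X \<times> Y)) * card (X \<inter> Y)"
  proof (rule card_eq_card_image_mult)
    fix z assume "z \<in> X \<times> Y"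
    then obtain a b where z: "z = (a, b)" "a \<in> X" "b \<in> Y" by auto
    have "bij_betw (\<lambda>d. (a \<otimes> d, inv d \<otimes> b)) (X \<inter> Y) {v \<in> X \<times> Y. ?f v = ?f z}"
    proof (rule bij_betw_imageI)
      show "inj_on (\<lambda>d. (a \<otimes> d, inv d \<otimes> b)) (X \<inter> Y)"
        using z XY by (auto intro!: inj_onI)
      show "(\<lambda>d. (a \<otimes> d, inv d \<otimes> b)) ` (X \<inter> Y) = {v \<in> X \<times> Y. ?f v = ?f z}"
      proof (intro equalityI subsetI)
        fix v assume "v \<in> (\<lambda>d. (a \<otimes> d, inv d \<otimes> b)) ` (X \<inter> Y)"
        then obtain d where "d \<in> X" "d \<in> Y" "v = (a \<otimes> d, inv d \<otimes> b)" by auto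
        then show "v \<in> {v \<in> X \<times> Y. ?f v = ?f z}"
          using z X Y XY by (auto simp: subgroup.m_closed subgroup.m_inv_closed m_assoc)
      next
        fix v assume "v \<in> {v \<in> X \<times> Y. ?f v = ?f z}"
        then obtain x y where v: "v = (x, y)" "x \<in> X" "y \<in> Y" "x \<otimes> y = a \<otimes> b" using z by auto
        define d where "d = inv a \<otimes> x"
        have "d \<in> X" using v z X by (simp add: d_def subgroup.m_closed subgroup.m_inv_closed)
        have b: "b = inv a \<otimes> (x \<otimes> y)" using v(4) z XY by simp
        have "d = b \<otimes> inv y" unfolding d_def b using v(2,3) z(2) XY by (simp add: m_assoc)
        then have "d \<in> Y" using v z Y by (simp add: subgroup.m_closed subgroup.m_inv_closed)
        have "x = a \<otimes> d" using v z XY by (simp add: d_def)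
        moreover have "y = inv d \<otimes> b"
          using \<open>d = b \<otimes> inv y\<close> v z XY by (simp add: inv_mult_group m_assoc)
        ultimately show "v \<in> (\<lambda>d. (a \<otimes> d, inv d \<otimes> b)) ` (X \<inter> Y)"
          using v \<open>d \<in> X\<close> \<open>d \<in> Y\<close> by auto
      qed
    qed
    then show "card {v \<in> X \<times> Y. ?f v = ?f z} = card (X \<inter> Y)"
      by (rule bij_betw_same_card[symmetric])
  qed (use fin in auto)
  moreover have "?f ` (X \<times> Y) = X <#> Y" 
    unfolding set_mult_def by force
  ultimately show ?thesis using fin by (simp add: card_cartesian_product)
qed

lemma card_subgroup_dvd:
  assumes "subgroup X G" "subgroup Y G" "X \<subseteq> Y"
  shows "card X dvd card Y"
proof -
  interpret Y: group "G\<lparr>carrier := Y\<rparr>" using assms(2) by (rule subgroup_imp_group)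
  have "subgroup X (G\<lparr>carrier := Y\<rparr>)" using assms by (simp add: subgroup_incl)
  from Y.lagrange[OF this] have "card (rcosets\<^bsub>G\<lparr>carrier := Y\<rparr>\<^esub> X) * card X = card Y"
    by (simp add: order_def)
  then show ?thesis by (metis dvd_triv_right)
qed

text \<open>Class equation: orbit sizes divide \<open>p ^ m\<close>, so an orbit of more than one
  point has size divisible by \<open>p\<close>. The action is a plain function whose laws are asked
  only on \<open>E\<close>; translation and conjugation of cosets are both instances.\<close>

lemma card_fixed_points_cong:
  assumes p: "prime (p::nat)" and ord: "order G = p ^ m" and E: "finite E"
    and closed: "\<And>g x. g \<in> carrier G \<Longrightarrow> x \<in> E \<Longrightarrow> act g x \<in> E"
    and one: "\<And>x. x \<in> E \<Longrightarrow> act \<one> x = x"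
    and mult: "\<And>g h x. g \<in> carrier G \<Longrightarrow> h \<in> carrier G \<Longrightarrow> x \<in> E \<Longrightarrow> act (g \<otimes> h) x = act g (act h x)"
  shows "card E mod p = card {x \<in> E. \<forall>g\<in>carrier G. act g x = x} mod p"
proof -
  have fin: "finite (carrier G)"
    using ord p order_gt_0_iff_finite by (simp add: prime_gt_0_nat)
  define Orb where "Orb x = (\<lambda>g. act g x) ` carrier G" for x
  define F where "F = {x \<in> E. \<forall>g\<in>carrier G. act g x = x}"
  have act_inv: "act (inv g) (act g x) = x" if "g \<in> carrier G" "x \<in> E" for g x
    using that mult[of "inv g" g x] one by simp
  have self: "x \<in> Orb x" if "x \<in> E" for x
    unfolding Orb_def by (rule image_eqI[of _ _ \<one>]) (use one that in auto)
  have Orb_sub: "Orb x \<subseteq> E" if "x \<in> E" for x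
    using that closed by (auto simp: Orb_def)
  have Orb_mono: "Orb y \<subseteq> Orb x" if "x \<in> E" "y \<in> Orb x" for x y
  proof -
    from that obtain g where g: "g \<in> carrier G" "y = act g x" by (auto simp: Orb_def)
    have "act h y = act (h \<otimes> g) x" if "h \<in> carrier G" for h
      using that g \<open>x \<in> E\<close> mult by simp
    then show ?thesis using g by (auto simp: Orb_def)
  qed
  have Orb_eq: "Orb y = Orb x" if "x \<in> E" "y \<in> Orb x" for x y
  proof -
    from that obtain g where g: "g \<in> carrier G" "y = act g x" by (auto simp: Orb_def)
    then have "x = act (inv g) y" using act_inv that by simp
    then have "x \<in> Orb y" using g by (auto simp: Orb_def)
    then show ?thesis using Orb_mono that Orb_sub by blast
  qed
  have Orb_dvd: "card (Orb x) dvd p ^ m" if x: "x \<in> E" for x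
  proof -
    \<comment> \<open>Orbit-stabilizer: the elements that move \<open>x\<close> to
      \<open>act a x\<close> form the left coset of the stabilizer through \<open>a\<close>.\<close>
    have "card (carrier G) = card (Orb x) * card {g \<in> carrier G. act g x = x}"
      unfolding Orb_def
    proof (rule card_eq_card_image_mult)
      fix a assume a: "a \<in> carrier G"
      have "bij_betw (\<lambda>g. a \<otimes> g) {g \<in> carrier G. act g x = x} {g \<in> carrier G. act g x = act a x}"
      proof (rule bij_betw_byWitness[where f' = "\<lambda>g. inv a \<otimes> g"])
        show "(\<lambda>g. inv a \<otimes> g) ` {g \<in> carrier G. act g x = act a x} \<subseteq> {g \<in> carrier G. act g x = x}"
          using a x act_inv by (simp add: image_subset_iff mult)
      qed (use a x mult in \<open>simp_all add: image_subset_iff\<close>)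
      then show "card {g \<in> carrier G. act g x = act a x} = card {g \<in> carrier G. act g x = x}"
        by (rule bij_betw_same_card[symmetric])
    qed (use fin in auto)
    then show ?thesis using ord by (metis dvd_triv_left order_def)
  qed
  \<comment> \<open>The nontrivial orbits are pairwise disjoint, and their union turns out to be
    exactly \<open>E - F\<close>.\<close>
  have "p dvd card (\<Union>(Orb ` (E - F)))"
  proof (rule dvd_partition)
    show "finite (\<Union>(Orb ` (E - F)))"
      using fin by (auto simp: E Orb_def)
    show "\<forall>c1\<in>Orb ` (E - F). \<forall>c2\<in>Orb ` (E - F). c1 \<noteq> c2 \<longrightarrow> c1 \<inter> c2 = {}"
      using Orb_eq by blast
    show "\<forall>c\<in>Orb ` (E - F). p dvd card c"
    proof
      fix c assume "c \<in> Orb ` (E - F)"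
      then obtain x where x: "x \<in> E" "x \<notin> F" "c = Orb x" by auto
      then obtain g where g: "g \<in> carrier G" "act g x \<noteq> x" by (auto simp: F_def)
      have "card c \<noteq> 1"
      proof
        assume "card c = 1"
        then obtain z where "c = {z}" by (auto simp: card_1_singleton_iff)
        then show False using x g self[of x] by (auto simp: Orb_def)
      qed
      moreover obtain i where "card c = p ^ i"
        using Orb_dvd[OF x(1)] x p by (auto simp: divides_primepow_nat)
      ultimately show "p dvd card c" by (cases i) auto
    qed
  qed
  moreover have "\<Union>(Orb ` (E - F)) = E - F"
  proof (intro equalityI subsetI)
    fix y assume "y \<in> \<Union>(Orb ` (E - F))"
    then obtain x where x: "x \<in> E" "x \<notin> F" "y \<in> Orb x" by auto
    have "x = y" if "y \<in> F"
    proof -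
      have "Orb y = {y}" using that one by (auto simp: Orb_def F_def)
      then show ?thesis using Orb_eq[OF x(1,3)] self[OF x(1)] by auto
    qed
    then show "y \<in> E - F" using x Orb_sub by auto
  qed (use self in auto)
  ultimately have "p dvd card (E - F)" by simp
  moreover have "card E = card (E - F) + card F"
    using E card_Un_disjoint[of "E - F" F] by (auto simp: F_def Un_absorb2)
  ultimately show ?thesis unfolding F_def by (auto simp: dvd_def)
qed

subsection \<open>Sylow conjugacy and invariant subgroups of prime index\<close>

lemma card_subgroup_pos: "subgroup S G \<Longrightarrow> finite S \<Longrightarrow> card S > 0"
  using subgroup.one_closed by (auto simp: card_gt_0_iff)

lemma l_coset_eq_iff:
  assumes S: "subgroup S G" and xy: "x \<in> carrier G" "y \<in> carrier G"
  shows "x <# S = y <# S \<longleftrightarrow> inv x \<otimes> y \<in> S"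
proof
  assume eq: "x <# S = y <# S"
  have "y \<in> y <# S"
    using subgroup.one_closed[OF S] xy by (force simp: l_coset_def)
  then obtain s where "s \<in> S" "y = x \<otimes> s"
    unfolding eq[symmetric] by (auto simp: l_coset_def)
  then show "inv x \<otimes> y \<in> S"
    using xy subgroup.mem_carrier[OF S] by simp
next
  assume s: "inv x \<otimes> y \<in> S"
  have "y <# S = x <# ((inv x \<otimes> y) <# S)"
    using xy subgroup.subset[OF S] by (simp add: lcos_m_assoc flip: m_assoc)
  also have "(inv x \<otimes> y) <# S = S"
    using s S xy by (intro coset_join3) auto
  finally show "x <# S = y <# S" by simp
qed

lemma r_coset_eq_iff:
  assumes S: "subgroup S G" and xy: "x \<in> carrier G" "y \<in> carrier G"
  shows "S #> x = S #> y \<longleftrightarrow> y \<otimes> inv x \<in> S"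
proof
  assume eq: "S #> x = S #> y"
  have "y \<in> S #> y"
    using subgroup.one_closed[OF S] xy by (force simp: r_coset_def)
  then obtain s where "s \<in> S" "y = s \<otimes> x"
    unfolding eq[symmetric] by (auto simp: r_coset_def)
  then show "y \<otimes> inv x \<in> S"
    using xy subgroup.mem_carrier[OF S] by (simp add: m_assoc)
next
  assume s: "y \<otimes> inv x \<in> S"
  have "S #> y = (S #> (y \<otimes> inv x)) #> x"
    using xy subgroup.subset[OF S] by (simp add: coset_mult_assoc m_assoc)
  also have "S #> (y \<otimes> inv x) = S"
    using s S xy by (intro coset_join2) auto
  finally show "S #> x = S #> y" by simp
qed

text \<open>The \<open>p\<close>-group \<open>T\<close> acts by left translation on the left cosets
  of \<open>S\<close> in \<open>Y\<close>. Their number \<open>c\<close> is prime to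
  \<open>p\<close>, so some coset \<open>yS\<close> is fixed, which means that
  \<open>y^-1 T y\<close> lies in \<open>S\<close>.\<close>

lemma sylow_conj:
  assumes p: "prime (p::nat)" and fin: "finite Y"
    and Y: "subgroup Y G" and S: "subgroup S G" "S \<subseteq> Y" and T: "subgroup T G" "T \<subseteq> Y"
    and card: "card T = p ^ m" "card Y = c * card S" "\<not> p dvd c"
  obtains y where "y \<in> Y" "\<And>t. t \<in> T \<Longrightarrow> inv y \<otimes> t \<otimes> y \<in> S"
proof -
  note YS = subgroup.mem_carrier[OF Y] subgroup.mem_carrier[OF S(1)] subgroup.mem_carrier[OF T(1)]
  interpret T: group "G\<lparr>carrier := T\<rparr>" using T(1) by (rule subgroup_imp_group)
  let ?f = "\<lambda>y. y <# S"
  have cardY: "card Y = card (?f ` Y) * card S"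
  proof (rule card_eq_card_image_mult[OF fin])
    fix y assume y: "y \<in> Y"
    have "{x \<in> Y. ?f x = ?f y} = {x \<in> Y. inv y \<otimes> x \<in> S}"
      using l_coset_eq_iff[OF S(1) YS(1) YS(1)] y by auto
    also have "\<dots> = (\<lambda>s. y \<otimes> s) ` S"
    proof (intro equalityI subsetI)
      fix x assume "x \<in> {x \<in> Y. inv y \<otimes> x \<in> S}"
      then show "x \<in> (\<lambda>s. y \<otimes> s) ` S"
        using y YS by (intro image_eqI[of _ _ "inv y \<otimes> x"]) auto
    qed (use y S Y YS in \<open>auto simp: subgroup.m_closed\<close>)
    also have "card \<dots> = card S"
      using y YS by (intro card_image inj_onI) simp
    finally show "card {x \<in> Y. ?f x = ?f y} = card S" .
  qed
  have "card S > 0" using S fin by (metis card_subgroup_pos finite_subset)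
  then have "\<not> p dvd card (?f ` Y)" using cardY card by simp
  moreover have "card (?f ` Y) mod p =
      card {C \<in> ?f ` Y. \<forall>t\<in>carrier (G\<lparr>carrier := T\<rparr>). t <# C = C} mod p"
  proof (rule T.card_fixed_points_cong[OF p])
    show "order (G\<lparr>carrier := T\<rparr>) = p ^ m" using card by (simp add: order_def)
    show "t <# C \<in> ?f ` Y" if t: "t \<in> carrier (G\<lparr>carrier := T\<rparr>)" and C: "C \<in> ?f ` Y" for t C
    proof -
      from C obtain y where y: "y \<in> Y" "C = y <# S" by auto
      then have "t <# C = (t \<otimes> y) <# S"
        using t YS subgroup.subset[OF S(1)] by (simp add: lcos_m_assoc)
      moreover have "t \<otimes> y \<in> Y" using t y T Y by (auto simp: subgroup.m_closed)
      ultimately show ?thesis by auto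
    qed
    have sub: "C \<subseteq> carrier G" if "C \<in> ?f ` Y" for C
      using that YS by (auto simp: l_coset_def)
    show "\<one>\<^bsub>G\<lparr>carrier := T\<rparr>\<^esub> <# C = C" if "C \<in> ?f ` Y" for C
      using sub[OF that] by (simp add: lcos_mult_one)
    show "(g \<otimes>\<^bsub>G\<lparr>carrier := T\<rparr>\<^esub> h) <# C = g <# (h <# C)"
      if "g \<in> carrier (G\<lparr>carrier := T\<rparr>)" "h \<in> carrier (G\<lparr>carrier := T\<rparr>)" "C \<in> ?f ` Y" for g h C
      using sub[OF that(3)] that YS by (simp add: lcos_m_assoc)
  qed (use fin in auto)
  \<comment> \<open>If there were no fixed coset, the number of cosets would be 0 modulo
    \<open>p\<close>.\<close>
  ultimately have "card {C \<in> ?f ` Y. \<forall>t\<in>T. t <# C = C} \<noteq> 0"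
    by (intro notI) (simp add: dvd_eq_mod_eq_0)
  then have "{C \<in> ?f ` Y. \<forall>t\<in>T. t <# C = C} \<noteq> {}"
    by (metis card.empty)
  then obtain y where y: "y \<in> Y" "\<And>t. t \<in> T \<Longrightarrow> t <# (y <# S) = y <# S" by auto
  show thesis
  proof (rule that[OF y(1)])
    fix t assume t: "t \<in> T"
    have "(t \<otimes> y) <# S = y <# S"
      using y(2)[OF t] t y(1) YS subgroup.subset[OF S(1)] by (simp add: lcos_m_assoc)
    then show "inv y \<otimes> t \<otimes> y \<in> S"
      using l_coset_eq_iff[OF S(1), of y "t \<otimes> y"] t y(1) YS by (simp add: m_assoc)
  qed
qed

text \<open>The quotient has a subgroup of order \<open>p\<close>, by Sylow existence with exponent
  1; \<open>L\<close> is its preimage, the union of the cosets in it.\<close>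

lemma ex_subgroup_prime_index_above:
  assumes p: "prime (p::nat)" and N: "N \<lhd> G" and dvd: "p dvd order (G Mod N)"
    and fin: "finite (carrier G)"
  obtains L where "subgroup L G" "N \<subseteq> L" "card L = p * card N"
proof -
  interpret N: normal N G by fact
  have "\<exists>T. subgroup T (G Mod N) \<and> card T = p ^ 1"
  proof (rule sylow_thm[OF p N.factorgroup_is_group])
    show "order (G Mod N) = p ^ 1 * (order (G Mod N) div p)" using dvd by simp
    show "finite (carrier (G Mod N))" using fin by (auto simp: FactGroup_def RCOSETS_def)
  qed
  then obtain T where T: "subgroup T (G Mod N)" "card T = p" by auto
  define L where "L = \<Union>T"
  have TR: "T \<subseteq> rcosets N" using subgroup.subset[OF T(1)] by (simp add: FactGroup_def)
  have L: "subgroup L G" unfolding L_def by (rule N.factgroup_subgroup_union_subgroup[OF T(1)])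
  have "card N * card T = card (\<Union>T)"
  proof (rule card_partition)
    show "finite T" using T p prime_gt_0_nat by (metis card_gt_0_iff)
    show "finite (\<Union>T)" using finite_subset[OF subgroup.subset[OF L] fin] by (simp add: L_def)
    show "card C = card N" if "C \<in> T" for C
      using that TR card_rcosets_equal[of C N] N.subset by auto
    show "C \<inter> D = {}" if "C \<in> T" "D \<in> T" "C \<noteq> D" for C D
      using that TR rcos_disjoint[OF N.is_subgroup] by (auto simp: pairwise_def disjnt_def)
  qed
  moreover have "N \<in> T" using subgroup.one_closed[OF T(1)] by (simp add: FactGroup_def)
  ultimately show thesis using that[OF L] T by (auto simp: L_def mult.commute)
qed

text \<open>\<open>P\<close> acts by conjugation on \<open>B/A\<close>, whose order is a positive
  power of \<open>p\<close>. The fixed points form a subgroup of order divisible by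
  \<open>p\<close>, which contains a subgroup of order \<open>p\<close>; its preimage is invariant
  under \<open>P\<close>.\<close>

lemma ex_setnormalized_prime_index_above:
  assumes p: "prime (p::nat)" and fin: "finite B"
    and P: "subgroup P G" "card P = p ^ m" "P \<subseteq> setnormalizer A" "P \<subseteq> setnormalizer B"
    and A: "subgroup A G" and B: "subgroup B G" "A \<subseteq> B" "B \<subseteq> setnormalizer A"
    and card: "card B = p ^ Suc j * card A"
  obtains L where "subgroup L G" "A \<subseteq> L" "L \<subseteq> B" "P \<subseteq> setnormalizer L" "card L = p * card A"
proof -
  note PAB = subgroup.mem_carrier[OF P(1)] subgroup.mem_carrier[OF A] subgroup.mem_carrier[OF B(1)]
  interpret P: group "G\<lparr>carrier := P\<rparr>" using P(1) by (rule subgroup_imp_group)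
  define c where "c g x = g \<otimes> x \<otimes> inv g" for g x
  have c_closed: "c g x \<in> carrier G" if "g \<in> carrier G" "x \<in> carrier G" for g x
    using that by (simp add: c_def)
  have c_B: "c g x \<in> B" if "g \<in> P" "x \<in> B" for g x
    using that P(4) by (auto simp: c_def setnormalizer_def)
  have c_A: "c g x \<in> A" if "g \<in> P" "x \<in> A" for g x
    using that P(3) by (auto simp: c_def setnormalizer_def)
  have c_A': "c g x \<in> A" if "g \<in> B" "x \<in> A" for g x
    using that B(3) by (auto simp: c_def setnormalizer_def)
  have c_mult: "c g (x \<otimes> y) = c g x \<otimes> c g y" if "g \<in> carrier G" "x \<in> carrier G" "y \<in> carrier G" for g x y
    using that by (simp add: c_def m_assoc)
  have c_inv: "c g (inv x) = inv (c g x)" if "g \<in> carrier G" "x \<in> carrier G" for g x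
    using that by (simp add: c_def m_assoc inv_mult_group)
  have c_c: "c (g \<otimes> h) x = c g (c h x)" if "g \<in> carrier G" "h \<in> carrier G" "x \<in> carrier G" for g h x
    using that by (simp add: c_def m_assoc inv_mult_group)
  let ?f = "\<lambda>x. A #> x"
  \<comment> \<open>\<open>Z/A\<close> is the group of fixed points of \<open>P\<close> on
    \<open>B/A\<close>, expressed by commutators so that no quotient group is needed.\<close>
  define Z where "Z = {x \<in> B. \<forall>g\<in>P. c g x \<otimes> inv x \<in> A}"
  have Z: "subgroup Z G"
  proof (rule subgroupI)
    show "Z \<subseteq> carrier G" using PAB by (auto simp: Z_def)
    have "\<one> \<in> Z" using PAB subgroup.one_closed[OF A] subgroup.one_closed[OF B(1)]
      by (auto simp: Z_def c_def)
    then show "Z \<noteq> {}" by auto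
  next
    fix x assume x: "x \<in> Z"
    have "c g (inv x) \<otimes> inv (inv x) \<in> A" if g: "g \<in> P" for g
    proof -
      have xB: "x \<in> B" using x by (simp add: Z_def)
      have "inv (c g x \<otimes> inv x) \<in> A"
        using x g subgroup.m_inv_closed[OF A] by (auto simp: Z_def)
      then have "c (inv x) (inv (c g x \<otimes> inv x)) \<in> A"
        using c_A' subgroup.m_inv_closed[OF B(1) xB] by blast
      also have "c (inv x) (inv (c g x \<otimes> inv x)) = c g (inv x) \<otimes> inv (inv x)"
        using xB g PAB by (simp add: c_def m_assoc inv_mult_group)
      finally show ?thesis .
    qed
    then show "inv x \<in> Z" using x subgroup.m_inv_closed[OF B(1)] by (simp add: Z_def)
  next
    fix x y assume xy: "x \<in> Z" "y \<in> Z"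
    have "c g (x \<otimes> y) \<otimes> inv (x \<otimes> y) \<in> A" if g: "g \<in> P" for g
    proof -
      have xyB: "x \<in> B" "y \<in> B" using xy by (simp_all add: Z_def)
      \<comment> \<open>The identity [g, xy] = [g, x] x [g, y] x^-1; the second factor stays in
        \<open>A\<close> because \<open>B\<close> normalizes \<open>A\<close>.\<close>
      have "(c g x \<otimes> inv x) \<otimes> c x (c g y \<otimes> inv y) \<in> A"
        using xy g c_A' subgroup.m_closed[OF A] by (simp add: Z_def)
      also have "(c g x \<otimes> inv x) \<otimes> c x (c g y \<otimes> inv y) = c g (x \<otimes> y) \<otimes> inv (x \<otimes> y)"
        using xyB g PAB by (simp add: c_def m_assoc inv_mult_group)
      finally show ?thesis .
    qed
    then show "x \<otimes> y \<in> Z" using xy subgroup.m_closed[OF B(1)] by (simp add: Z_def)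
  qed
  have AZ: "A \<subseteq> Z"
    using B(2) c_A subgroup.m_closed[OF A] subgroup.m_inv_closed[OF A] by (auto simp: Z_def)
  have card_cosets: "card D = card (?f ` D) * card A"
    if D: "subgroup D G" "A \<subseteq> D" "D \<subseteq> B" for D
  proof (rule card_eq_card_image_mult)
    show "finite D" using D(3) fin by (rule finite_subset)
    fix y assume y: "y \<in> D"
    note mem = subgroup.mem_carrier[OF D(1)] PAB(2)
    have "{x \<in> D. ?f x = ?f y} = {x \<in> D. x \<otimes> inv y \<in> A}"
      using r_coset_eq_iff[OF A mem(1) mem(1)] y by auto
    also have "\<dots> = (\<lambda>a. a \<otimes> y) ` A"
    proof (intro equalityI subsetI)
      fix x assume "x \<in> {x \<in> D. x \<otimes> inv y \<in> A}"
      then show "x \<in> (\<lambda>a. a \<otimes> y) ` A"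
        using y mem by (intro image_eqI[of _ _ "x \<otimes> inv y"]) (auto simp: m_assoc)
    qed (use y D mem in \<open>auto simp: subgroup.m_closed m_assoc\<close>)
    also have "card \<dots> = card A"
      using y mem by (intro card_image inj_onI) simp
    finally show "card {x \<in> D. ?f x = ?f y} = card A" .
  qed
  have Apos: "card A > 0" using A B fin by (metis card_subgroup_pos finite_subset)
  have c_coset: "c g ` (?f x) = ?f (c g x)" if "g \<in> P" "x \<in> B" for g x
  proof (intro equalityI subsetI)
    fix z assume "z \<in> c g ` (?f x)"
    then obtain a where "a \<in> A" "z = c g (a \<otimes> x)" by (auto simp: r_coset_def)
    then show "z \<in> ?f (c g x)" using that PAB c_A c_mult by (auto simp: r_coset_def)
  next
    fix z assume "z \<in> ?f (c g x)"
    then obtain a where a: "a \<in> A" "z = a \<otimes> c g x" by (auto simp: r_coset_def)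
    have "c (inv g) a \<in> A" using a that c_A subgroup.m_inv_closed[OF P(1)] by blast
    moreover have "z = c g (c (inv g) a \<otimes> x)"
      using a that PAB by (simp add: c_def m_assoc inv_mult_group)
    ultimately show "z \<in> c g ` (?f x)" by (auto simp: r_coset_def)
  qed
  have "card (?f ` B) mod p = card {C \<in> ?f ` B. \<forall>g\<in>carrier (G\<lparr>carrier := P\<rparr>). c g ` C = C} mod p"
  proof (rule P.card_fixed_points_cong[OF p])
    show "order (G\<lparr>carrier := P\<rparr>) = p ^ m" using P by (simp add: order_def)
    show "c g ` C \<in> ?f ` B" if "g \<in> carrier (G\<lparr>carrier := P\<rparr>)" "C \<in> ?f ` B" for g C
      using that c_coset c_B by auto
    have sub: "C \<subseteq> carrier G" if "C \<in> ?f ` B" for C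
      using that PAB by (auto simp: r_coset_def)
    show "c \<one>\<^bsub>G\<lparr>carrier := P\<rparr>\<^esub> ` C = C" if "C \<in> ?f ` B" for C
    proof -
      have "c \<one> x = x" if "x \<in> C" for x
        using sub[OF \<open>C \<in> ?f ` B\<close>] that by (auto simp: c_def)
      then show ?thesis by simp
    qed
    show "c (g \<otimes>\<^bsub>G\<lparr>carrier := P\<rparr>\<^esub> h) ` C = c g ` (c h ` C)"
      if "g \<in> carrier (G\<lparr>carrier := P\<rparr>)" "h \<in> carrier (G\<lparr>carrier := P\<rparr>)" "C \<in> ?f ` B" for g h C
      unfolding image_image using that sub[OF that(3)] PAB by (intro image_cong) (auto simp: c_c)
  qed (use fin in auto)
  \<comment> \<open>The coset of \<open>x\<close> is fixed by \<open>g\<close> exactly when the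
    commutator of \<open>g\<close> and \<open>x\<close> lies in \<open>A\<close>, so the fixed
    cosets are those represented in \<open>Z\<close>.\<close>
  also have "{C \<in> ?f ` B. \<forall>g\<in>carrier (G\<lparr>carrier := P\<rparr>). c g ` C = C} = ?f ` Z"
  proof -
    have "(\<forall>g\<in>P. c g ` (?f x) = ?f x) \<longleftrightarrow> x \<in> Z" if "x \<in> B" for x
    proof -
      have "c g ` (?f x) = ?f x \<longleftrightarrow> c g x \<otimes> inv x \<in> A" if "g \<in> P" for g
        using r_coset_eq_iff[OF A, of x "c g x"] c_coset \<open>x \<in> B\<close> that PAB c_closed
        by (metis (full_types))
      then show ?thesis using that by (simp add: Z_def)
    qed
    moreover have "Z \<subseteq> B" by (auto simp: Z_def)
    ultimately show ?thesis by auto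
  qed
  finally have "card (?f ` B) mod p = card (?f ` Z) mod p" .
  moreover have "card (?f ` B) = p ^ Suc j" using card_cosets[OF B(1,2)] card Apos by simp
  ultimately have pdvd: "p dvd card (?f ` Z)" by (simp add: mod_eq_0_iff_dvd)
  interpret Z: group "G\<lparr>carrier := Z\<rparr>" using Z by (rule subgroup_imp_group)
  have ZB: "Z \<subseteq> B" by (auto simp: Z_def)
  have "A \<lhd> G\<lparr>carrier := Z\<rparr>"
    unfolding Z.normal_inv_iff
  proof (intro conjI ballI)
    show "subgroup A (G\<lparr>carrier := Z\<rparr>)" using A Z AZ by (rule subgroup_incl)
    show "x \<otimes>\<^bsub>G\<lparr>carrier := Z\<rparr>\<^esub> h \<otimes>\<^bsub>G\<lparr>carrier := Z\<rparr>\<^esub> inv\<^bsub>G\<lparr>carrier := Z\<rparr>\<^esub> x \<in> A"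
      if "x \<in> carrier (G\<lparr>carrier := Z\<rparr>)" "h \<in> A" for x h
      using that c_A'[of x h] ZB Z by (auto simp: c_def m_inv_consistent)
  qed
  moreover have "order (G\<lparr>carrier := Z\<rparr> Mod A) = card (?f ` Z)"
    by (simp add: order_def FactGroup_def RCOSETS_def UNION_singleton_eq_range)
  moreover have "finite (carrier (G\<lparr>carrier := Z\<rparr>))" using fin ZB by (simp add: finite_subset)
  ultimately obtain L where L: "subgroup L (G\<lparr>carrier := Z\<rparr>)" "A \<subseteq> L" "card L = p * card A"
    using Z.ex_subgroup_prime_index_above[OF p] pdvd by metis
  have LZ: "L \<subseteq> Z" using subgroup.subset[OF L(1)] by simp
  have LG: "subgroup L G" using Z L(1) by (rule incl_subgroup)
  \<comment> \<open>Any subgroup between \<open>A\<close> and \<open>Z\<close> is invariant: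
    conjugation by \<open>P\<close> multiplies an element of \<open>Z\<close> by an element of
    \<open>A\<close>.\<close>
  have "P \<subseteq> setnormalizer L"
  proof
    fix g assume g: "g \<in> P"
    have "g \<otimes> x \<otimes> inv g \<in> L" if "x \<in> L" for x
    proof -
      have "c g x \<otimes> inv x \<in> L" using that LZ L(2) g by (auto simp: Z_def)
      then have "c g x \<otimes> inv x \<otimes> x \<in> L" using that subgroup.m_closed[OF LG] by blast
      moreover have "c g x \<otimes> inv x \<otimes> x = g \<otimes> x \<otimes> inv g"
        using that g PAB subgroup.mem_carrier[OF LG] by (simp add: c_def m_assoc)
      ultimately show ?thesis by simp
    qed
    then show "g \<in> setnormalizer L" using g PAB by (simp add: setnormalizer_def)
  qed
  then show thesis using that LG L(2,3) LZ ZB by blast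
qed

subsection \<open>Maximal chains and \<open>S\<close>-quasinormal subgroups\<close>

text \<open>The pairs go downwards, from a subgroup to its maximal subgroups. As a relation, maximal
  chains become relational powers, which can be joined and cut with
  \<open>relpow_add\<close>.\<close>

definition maximal_rel :: "('a set \<times> 'a set) set" where
  "maximal_rel = {(L, M). maximal_subgroup M (G\<lparr>carrier := L\<rparr>)}"

lemma n_maximal_subgroup_iff: "n_maximal_subgroup n H G \<longleftrightarrow> (carrier G, H) \<in> maximal_rel ^^ n"
  by (simp add: n_maximal_subgroup_def relpow_fun_conv maximal_rel_def)

lemma maximal_rel_iff:
  assumes L: "subgroup L G"
  shows "(L, M) \<in> maximal_rel \<longleftrightarrow>
    subgroup M G \<and> M \<subset> L \<and> (\<forall>Y. subgroup Y G \<and> M \<subseteq> Y \<and> Y \<subseteq> L \<longrightarrow> Y = M \<or> Y = L)"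
proof -
  have "subgroup Y (G\<lparr>carrier := L\<rparr>) \<longleftrightarrow> subgroup Y G \<and> Y \<subseteq> L" for Y
    using incl_subgroup[OF L] subgroup_incl[OF _ L] subgroup.subset[of Y "G\<lparr>carrier := L\<rparr>"] by auto
  then show ?thesis by (auto simp: maximal_rel_def maximal_subgroup_def)
qed

lemma maximal_relpow_subgroup:
  assumes "subgroup L G" "(L, M) \<in> maximal_rel ^^ n"
  shows "subgroup M G \<and> M \<subseteq> L"
  using assms(2)
proof (induction n arbitrary: M)
  case (Suc n)
  then obtain Y where "(L, Y) \<in> maximal_rel ^^ n" "(Y, M) \<in> maximal_rel" by auto
  then show ?case using Suc.IH[of Y] by (auto simp: maximal_rel_iff)
qed (use assms in auto)

lemma ex_maximal_above:
  assumes L: "subgroup L G" "finite L" and M: "subgroup M G" "M \<subset> L"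
  obtains Y where "(L, Y) \<in> maximal_rel" "M \<subseteq> Y"
proof -
  let ?S = "{Y. subgroup Y G \<and> M \<subseteq> Y \<and> Y \<subset> L}"
  have "finite ?S" using L by (auto intro: finite_subset[of _ "Pow L"])
  moreover have "M \<in> ?S" using M by auto
  ultimately obtain Y where Y: "Y \<in> ?S" "M \<subseteq> Y" "\<And>Z. Z \<in> ?S \<Longrightarrow> Y \<subseteq> Z \<Longrightarrow> Y = Z"
    using finite_has_maximal2[of ?S M] by auto
  then have "(L, Y) \<in> maximal_rel" unfolding maximal_rel_iff[OF L(1)] by blast
  then show thesis using that Y by blast
qed

lemma ex_maximal_relpow:
  assumes "finite L" "subgroup L G" "subgroup M G" "M \<subseteq> L"
  obtains l where "(L, M) \<in> maximal_rel ^^ l"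
proof -
  have "\<exists>l. (L, M) \<in> maximal_rel ^^ l"
    using assms
  proof (induction L rule: finite_psubset_induct)
    case (psubset L)
    show ?case
    proof (cases "M = L")
      case True
      then have "(L, M) \<in> maximal_rel ^^ 0" by simp
      then show ?thesis by blast
    next
      case False
      then obtain Y where Y: "(L, Y) \<in> maximal_rel" "M \<subseteq> Y"
        using ex_maximal_above[OF psubset(3,1,4)] psubset(5) by blast
      then have "Y \<subset> L" "subgroup Y G" using maximal_rel_iff[OF psubset(3)] by auto
      with psubset Y obtain l where "(Y, M) \<in> maximal_rel ^^ l" by blast
      with Y(1) show ?thesis by (meson relpow_Suc_I2)
    qed
  qed
  then show thesis using that by blast
qed

lemma maximal_rel_prime_index:
  assumes p: "prime p" and L: "subgroup L G" "finite L" and M: "subgroup M G" "M \<subseteq> L"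
    and card: "card L = p * card M"
  shows "(L, M) \<in> maximal_rel"
proof -
  have pos: "card M > 0" using M L by (metis card_subgroup_pos finite_subset)
  then have "M \<noteq> L" using card p prime_gt_1_nat[of p] by auto
  moreover have "Y = M \<or> Y = L" if Y: "subgroup Y G" "M \<subseteq> Y" "Y \<subseteq> L" for Y
  proof -
    obtain u where u: "card Y = card M * u" using card_subgroup_dvd[OF M(1) Y(1,2)] by (auto simp: dvd_def)
    obtain v where v: "card L = card Y * v" using card_subgroup_dvd[OF Y(1) L(1) Y(3)] by (auto simp: dvd_def)
    have "p = u * v" using u v card pos by simp
    then consider "u = 1" | "v = 1" using p by (metis prime_product)
    then show ?thesis
    proof cases
      case 1
      then have "M = Y" using u Y(2) finite_subset[OF Y(3) L(2)] by (intro card_subset_eq) auto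
      then show ?thesis by simp
    next
      case 2
      then have "Y = L" using v Y(3) L(2) by (intro card_subset_eq) auto
      then show ?thesis by simp
    qed
  qed
  ultimately show ?thesis using M unfolding maximal_rel_iff[OF L(1)] by blast
qed

section \<open>Intersections with \<open>S\<close>-quasinormal subgroups and with Sylow
  subgroups\<close>

lemma S_quasinormal_subgroup_set_mult:
  assumes "S_quasinormal X G" "sylow_subgroup R G"
  shows "subgroup (X <#> R) G"
  using assms by (intro subgroup_set_mult) (auto simp: S_quasinormal_def sylow_subgroup_def)

lemma coprime_prime_powers:
  assumes "prime (p::nat)" "prime r" "p \<noteq> r" "d dvd p ^ i" "d dvd r ^ j"
  shows "d = 1"
proof -
  have "coprime (p ^ i) (r ^ j)" using assms by (simp add: primes_coprime)
  then show ?thesis using assms(4,5) coprime_common_divisor_nat by blast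
qed

lemma setnormalizer_Int_normal:
  assumes H: "H \<lhd> G" and U: "subgroup U G"
  shows "U \<subseteq> setnormalizer (U \<inter> H)"
  using H subgroup.mem_carrier[OF U] subgroup.m_closed[OF U] subgroup.m_inv_closed[OF U]
  by (auto simp: setnormalizer_def normal_inv_iff)

text \<open>With \<open>U = XR\<close>, the index \<open>d\<close> of \<open>X \<inter> H\<close> in
  \<open>U \<inter> H\<close> divides the order of \<open>R\<close>, a power of \<open>r\<close>,
  and also \<open>p ^ k\<close>. So \<open>d = 1\<close>, and \<open>U\<close>, which contains
  \<open>R\<close>, normalizes \<open>U \<inter> H = X \<inter> H\<close>.\<close>

lemma sylow_setnormalizes_Int:
  assumes fin: "finite (carrier G)" and X: "S_quasinormal X G"
    and H: "H \<lhd> G" and K: "subgroup K G" "K \<subseteq> X \<inter> H" "card H = p ^ k * card K"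
    and pr: "prime p" "prime r" "p \<noteq> r" and R: "sylow_subgroup R G" "card R = r ^ j"
  shows "R \<subseteq> setnormalizer (X \<inter> H)"
proof -
  have sX: "subgroup X G" using X by (simp add: S_quasinormal_def)
  have sR: "subgroup R G" using R by (simp add: sylow_subgroup_def)
  have sH: "subgroup H G" using H by (rule normal_imp_subgroup)
  define U where "U = X <#> R"
  have sU: "subgroup U G" unfolding U_def by (rule S_quasinormal_subgroup_set_mult[OF X R(1)])
  have XU: "X \<subseteq> U" "R \<subseteq> U"
    using left_subset_set_mult[OF sX sR] right_subset_set_mult[OF sX sR] by (auto simp: U_def)
  have sUH: "subgroup (U \<inter> H) G" "subgroup (X \<inter> H) G" using sU sH sX by (simp_all add: subgroups_Inter_pair)
  have finX: "finite Y" if "subgroup Y G" for Y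
    using subgroup.subset[OF that] fin by (rule finite_subset)
  have pos: "card Y > 0" if "subgroup Y G" for Y
    using card_subgroup_pos[OF that finX[OF that]] .
  obtain d where d: "card (U \<inter> H) = card (X \<inter> H) * d"
    using card_subgroup_dvd[OF sUH(2,1)] XU by (auto simp: dvd_def)
  \<comment> \<open>Inside \<open>U\<close>, the subgroup \<open>D\<close> has index
    \<open>d\<close> over \<open>X\<close>; this carries \<open>d\<close> over to a divisor of the
    index of \<open>X\<close> in \<open>U\<close>.\<close>
  define D where "D = X <#> (U \<inter> H)"
  have sD: "subgroup D G" unfolding D_def
    using setnormalizer_Int_normal[OF H sU] XU sX sUH
    by (intro subgroup_set_mult set_mult_commute_if_setnormalizer) auto
  have "card D * card (X \<inter> H) = card X * (card (X \<inter> H) * d)"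
    using card_set_mult[OF sX sUH(1)] finX sX sUH XU d by (simp add: D_def Int_absorb2 flip: Int_assoc)
  then have D: "card D = card X * d" using pos[OF sUH(2)] by simp
  have "D \<subseteq> U" unfolding D_def using XU by (intro set_mult_subset_subgroup[OF sU]) auto
  then have "card D dvd card U" using card_subgroup_dvd sD sU by blast
  also have "card U dvd card X * r ^ j"
    using card_set_mult[OF sX sR] finX sX sR R(2) unfolding U_def by (metis dvd_triv_left)
  finally have "d dvd r ^ j" using D pos[OF sX] by simp
  moreover have "d dvd p ^ k"
  proof -
    have "card (X \<inter> H) * d dvd p ^ k * card K"
      using card_subgroup_dvd[OF sUH(1) sH] K(3) d by simp
    also have "\<dots> dvd p ^ k * card (X \<inter> H)"
      using card_subgroup_dvd[OF K(1) sUH(2) K(2)] by simp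
    finally show ?thesis using pos[OF sUH(2)] by (simp add: mult.commute)
  qed
  ultimately have "d = 1" using coprime_prime_powers pr by blast
  then have "X \<inter> H = U \<inter> H"
    using d XU finX[OF sUH(1)] by (intro card_subset_eq) auto
  then show ?thesis using setnormalizer_Int_normal[OF H sU] XU by auto
qed

lemma conj_subgroup:
  assumes S: "subgroup S G" and x: "x \<in> carrier G"
  shows "subgroup ((\<lambda>s. x \<otimes> s \<otimes> inv x) ` S) G" "card ((\<lambda>s. x \<otimes> s \<otimes> inv x) ` S) = card S"
proof -
  note mem = subgroup.mem_carrier[OF S]
  show "subgroup ((\<lambda>s. x \<otimes> s \<otimes> inv x) ` S) G"
  proof (rule subgroupI)
    show "(\<lambda>s. x \<otimes> s \<otimes> inv x) ` S \<noteq> {}" using subgroup.one_closed[OF S] by auto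
    fix a assume "a \<in> (\<lambda>s. x \<otimes> s \<otimes> inv x) ` S"
    then obtain s where s: "s \<in> S" "a = x \<otimes> s \<otimes> inv x" by auto
    then have "inv a = x \<otimes> inv s \<otimes> inv x" using mem x by (simp add: m_assoc inv_mult_group)
    then show "inv a \<in> (\<lambda>s. x \<otimes> s \<otimes> inv x) ` S" using s subgroup.m_inv_closed[OF S] by blast
    fix b assume "b \<in> (\<lambda>s. x \<otimes> s \<otimes> inv x) ` S"
    then obtain t where t: "t \<in> S" "b = x \<otimes> t \<otimes> inv x" by auto
    then have "a \<otimes> b = x \<otimes> (s \<otimes> t) \<otimes> inv x" using s mem x by (simp add: m_assoc)
    then show "a \<otimes> b \<in> (\<lambda>s. x \<otimes> s \<otimes> inv x) ` S" using s t subgroup.m_closed[OF S] by blast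
  qed (use mem x in auto)
  show "card ((\<lambda>s. x \<otimes> s \<otimes> inv x) ` S) = card S"
    using mem x by (intro card_image inj_onI) simp
qed

text \<open>Frattini argument. Otherwise a maximal subgroup \<open>Y\<close> of \<open>W\<close>
  contains the normalizer in \<open>W\<close> of \<open>S = Q \<inter> W\<close>. Since
  \<open>Y\<close> permutes with every conjugate of \<open>Q\<close>, it contains all
  \<open>W\<close>-conjugates of \<open>S\<close>; these are conjugate to \<open>S\<close> already
  in \<open>Y\<close>, which forces \<open>Y = W\<close>.\<close>

lemma sylow_Int_setnormalized:
  assumes fin: "finite (carrier G)" and W: "subgroup W G"
    and Q: "sylow_subgroup Q G" "prime q" "card Q = q ^ multiplicity q (order G)"
    and WQ: "subgroup (W <#> Q) G"
    and max: "\<And>Y. (W, Y) \<in> maximal_rel \<Longrightarrow> S_quasinormal Y G"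
  shows "W \<subseteq> setnormalizer (Q \<inter> W)"
proof (rule ccontr)
  have finX: "finite Y" if "subgroup Y G" for Y
    using subgroup.subset[OF that] fin by (rule finite_subset)
  have pos: "card Y > 0" if "subgroup Y G" for Y
    using card_subgroup_pos[OF that finX[OF that]] .
  have sQ: "subgroup Q G" using Q by (simp add: sylow_subgroup_def)
  define S where "S = Q \<inter> W"
  have sS: "subgroup S G" using sQ W by (simp add: S_def subgroups_Inter_pair)
  have sN: "subgroup (setnormalizer S) G"
    using setnormalizer_subgroup finX[OF sS] subgroup.subset[OF sS] by blast
  define D where "D = setnormalizer S \<inter> W"
  have sD: "subgroup D G" using sN W by (simp add: D_def subgroups_Inter_pair)
  assume "\<not> W \<subseteq> setnormalizer (Q \<inter> W)"
  then have "D \<subset> W" by (auto simp: D_def S_def)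
  then obtain Y where Y: "(W, Y) \<in> maximal_rel" "D \<subseteq> Y"
    using ex_maximal_above[OF W finX[OF W] sD] by blast
  have sY: "subgroup Y G" "Y \<subset> W" using Y maximal_rel_iff[OF W] by auto
  have SY: "S \<subseteq> Y" using subgroup_subset_setnormalizer[OF sS] Y by (auto simp: D_def S_def)
  obtain c where c: "card W = card S * c"
    using card_subgroup_dvd[OF sS W] by (auto simp: S_def dvd_def)
  \<comment> \<open>\<open>S\<close> is a Sylow \<open>q\<close>-subgroup of \<open>W\<close>: the
    index \<open>c\<close> equals that of \<open>Q\<close> in the subgroup \<open>WQ\<close>, and
    \<open>Q\<close> is a Sylow subgroup of the whole group.\<close>
  have c': "\<not> q dvd c"
  proof
    assume "q dvd c"
    have "card (W <#> Q) * card S = card W * card Q"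
      using card_set_mult[OF W sQ] finX W sQ by (simp add: S_def Int_commute)
    then have "card (W <#> Q) = c * card Q" using c pos[OF sS] by simp
    moreover have "card (W <#> Q) dvd order G"
      using card_subgroup_dvd[OF WQ subgroup_self] subgroup.subset[OF WQ] by (simp add: order_def)
    moreover have "q * card Q dvd c * card Q"
      using \<open>q dvd c\<close> by (rule mult_dvd_mono) simp
    ultimately have "q * card Q dvd order G" by (metis dvd_trans)
    then have "q ^ Suc (multiplicity q (order G)) dvd order G" using Q(3) by simp
    moreover have "order G \<noteq> 0" using fin order_gt_0_iff_finite by auto
    ultimately show False using Q(2)
      by (metis Suc_n_not_le_n multiplicity_geI not_prime_unit)
  qed
  obtain e where e: "card Y = card S * e" "e dvd c"
  proof -
    obtain e where "card Y = card S * e" using card_subgroup_dvd[OF sS sY(1) SY] by (auto simp: dvd_def)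
    moreover have "card Y dvd card W" using card_subgroup_dvd sY W by blast
    ultimately show thesis using that c pos[OF sS] by auto
  qed
  obtain i where i: "card S = q ^ i"
    using card_subgroup_dvd[OF sS sQ] Q by (auto simp: S_def divides_primepow_nat)
  have "x \<in> Y" if x: "x \<in> W" for x
  proof -
    have xG: "x \<in> carrier G" using x subgroup.mem_carrier[OF W] by blast
    let ?c = "\<lambda>s. x \<otimes> s \<otimes> inv x"
    define T where "T = ?c ` S"
    define Q' where "Q' = ?c ` Q"
    note memQ = subgroup.mem_carrier[OF sQ]
    have sT: "subgroup T G" and cT: "card T = q ^ i"
      using conj_subgroup[OF sS xG] i by (simp_all add: T_def)
    have sQ': "subgroup Q' G" "card Q' = card Q"
      using conj_subgroup[OF sQ xG] by (simp_all add: Q'_def)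
    have T: "T = Q' \<inter> W"
    proof (intro equalityI subsetI)
      fix z assume "z \<in> T"
      then show "z \<in> Q' \<inter> W"
        using x W by (auto simp: T_def Q'_def S_def subgroup.m_closed subgroup.m_inv_closed)
    next
      fix z assume z: "z \<in> Q' \<inter> W"
      then obtain s where s: "s \<in> Q" "z = ?c s" by (auto simp: Q'_def)
      have "s = inv x \<otimes> z \<otimes> x" using s xG memQ by (simp add: m_assoc)
      also have "\<dots> \<in> W" using z x W by (simp add: subgroup.m_closed subgroup.m_inv_closed)
      finally show "z \<in> T" using s by (auto simp: T_def S_def)
    qed
    have "sylow_subgroup Q' G" using sQ' Q(2,3) by (auto simp: sylow_subgroup_def)
    then have sU: "subgroup (Y <#> Q') G"
      using S_quasinormal_subgroup_set_mult max[OF Y(1)] by blast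
    define V where "V = (Y <#> Q') \<inter> W"
    have sV: "subgroup V G" using sU W by (simp add: V_def subgroups_Inter_pair)
    have YV: "Y \<subseteq> V" using left_subset_set_mult[OF sY(1) sQ'(1)] sY by (auto simp: V_def)
    have TV: "T \<subseteq> V" using right_subset_set_mult[OF sY(1) sQ'(1)] T by (auto simp: V_def)
    \<comment> \<open>Dedekind's law: \<open>YQ' \<inter> W = Y(Q' \<inter> W)\<close>, because
      \<open>Y\<close> lies in \<open>W\<close>.\<close>
    have "V \<subseteq> Y <#> T"
    proof
      fix v assume v: "v \<in> V"
      then obtain y t where yt: "y \<in> Y" "t \<in> Q'" "v = y \<otimes> t" by (auto simp: V_def set_mult_iff)
      then have "t = inv y \<otimes> v"
        using subgroup.mem_carrier[OF sY(1)] subgroup.mem_carrier[OF sQ'(1)] by simp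
      also have "\<dots> \<in> W" using v yt sY W by (auto simp: V_def subgroup.m_closed subgroup.m_inv_closed)
      finally show "v \<in> Y <#> T" using yt T by (auto simp: set_mult_iff)
    qed
    then have V: "V = Y <#> T" using set_mult_subset_subgroup[OF sV YV TV] by auto
    obtain d where d: "card V = card Y * d" using card_subgroup_dvd[OF sY(1) sV YV] by (auto simp: dvd_def)
    have "card Y * d * card (Y \<inter> T) = card Y * q ^ i"
      using card_set_mult[OF sY(1) sT] finX sY sT cT d by (simp add: V[symmetric])
    then have "d * card (Y \<inter> T) = q ^ i" using pos[OF sY(1)] by simp
    then have "d dvd q ^ i" by (metis dvd_triv_left)
    then obtain j where j: "d = q ^ j" using Q(2) by (auto simp: divides_primepow_nat)
    have "card V dvd card W" using card_subgroup_dvd[OF sV W] by (auto simp: V_def)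
    \<comment> \<open>The index of \<open>S\<close> in \<open>V\<close> is \<open>e * d\<close>. So
      the power \<open>d\<close> of \<open>q\<close> divides \<open>c\<close>, which is prime to
      \<open>q\<close>; this leaves \<open>d = 1\<close>.\<close>
    then have "e * d dvd c" using d c e(1) pos[OF sS] by (simp add: mult.assoc)
    then have "d dvd c" by (rule dvd_mult_right)
    then have "d = 1" using j c' by (cases j) (auto dest: dvd_mult_left)
    then have "V = Y" using d YV finX[OF sV] by (metis card_subset_eq mult.right_neutral)
    then have TY: "T \<subseteq> Y" using TV by simp
    have "\<not> q dvd e" using c' e by (meson dvd_trans)
    then obtain y where y: "y \<in> Y" "\<And>t. t \<in> T \<Longrightarrow> inv y \<otimes> t \<otimes> y \<in> S"
      using sylow_conj[OF Q(2) finX[OF sY(1)] sY(1) sS SY sT TY cT, of e] e by (auto simp: mult.commute)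
    have yG: "y \<in> carrier G" and yW: "y \<in> W" using y sY subgroup.mem_carrier[OF W] by auto
    have "inv y \<otimes> x \<in> setnormalizer S"
    proof -
      have "inv y \<otimes> x \<otimes> s \<otimes> inv (inv y \<otimes> x) \<in> S" if s: "s \<in> S" for s
      proof -
        have "inv y \<otimes> (x \<otimes> s \<otimes> inv x) \<otimes> y \<in> S" using y s by (simp add: T_def)
        then show ?thesis
          using s yG xG subgroup.mem_carrier[OF sS] by (simp add: m_assoc inv_mult_group)
      qed
      then show ?thesis using yG xG by (simp add: setnormalizer_def)
    qed
    moreover have "inv y \<otimes> x \<in> W" using x yW W by (simp add: subgroup.m_closed subgroup.m_inv_closed)
    ultimately have "inv y \<otimes> x \<in> Y" using Y by (auto simp: D_def)
    then have "y \<otimes> (inv y \<otimes> x) \<in> Y" by (rule subgroup.m_closed[OF sY(1) y(1)])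
    then show "x \<in> Y" using yG xG by simp
  qed
  then show False using sY by auto
qed

subsection \<open>Chief factors\<close>

text \<open>The image of the \<open>q\<close>-group \<open>H \<inter> Q\<close> in the
  \<open>p\<close>-group \<open>H/K\<close> is trivial. In the proof, \<open>e\<close> is the order
  of that image.\<close>

lemma normal_section_Int_subset:
  assumes fin: "finite (carrier G)" and K: "K \<lhd> G" and H: "subgroup H G" "K \<subseteq> H"
    and card: "card H = p ^ k * card K"
    and pq: "prime p" "prime q" "p \<noteq> q" and Q: "subgroup Q G" "card Q = q ^ j"
  shows "H \<inter> Q \<subseteq> K"
proof -
  have sK: "subgroup K G" using K by (rule normal_imp_subgroup)
  have finX: "finite Y" if "subgroup Y G" for Y
    using subgroup.subset[OF that] fin by (rule finite_subset)
  define S where "S = H \<inter> Q"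
  have sS: "subgroup S G" using H Q by (simp add: S_def subgroups_Inter_pair)
  have "S <#> K = K <#> S"
    using K subgroup.subset[OF sS] by (intro set_mult_commute_if_setnormalizer) (auto simp: sS normal_iff_setnormalizer)
  then have sD: "subgroup (K <#> S) G" using subgroup_set_mult[OF sK sS] by simp
  have KD: "K \<subseteq> K <#> S" by (rule left_subset_set_mult[OF sK sS])
  obtain e where e: "card (K <#> S) = card K * e"
    using card_subgroup_dvd[OF sK sD KD] by (auto simp: dvd_def)
  have pos: "card K > 0" using card_subgroup_pos[OF sK finX[OF sK]] .
  have "card (K <#> S) dvd card H"
    using H by (intro card_subgroup_dvd sD set_mult_subset_subgroup) (auto simp: S_def)
  then have "e dvd p ^ k" using e card pos by (simp add: mult.commute)
  moreover have "e dvd q ^ j"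
  proof -
    have "e * card (K \<inter> S) = card S"
      using card_set_mult[OF sK sS finX[OF sK] finX[OF sS]] e pos by simp
    moreover have "card S dvd q ^ j" using card_subgroup_dvd[OF sS Q(1)] Q(2) by (simp add: S_def)
    ultimately show ?thesis by (metis dvd_mult_left)
  qed
  ultimately have "e = 1" using coprime_prime_powers pq by blast
  then have "K = K <#> S" using e KD finX[OF sD] by (intro card_subset_eq) auto
  then show ?thesis using right_subset_set_mult[OF sK sS] by (simp add: S_def)
qed

text \<open>The index of \<open>KP\<close> in \<open>HP\<close> is a power of \<open>p\<close> by
  the product formula, and prime to \<open>p\<close> because \<open>KP\<close> contains the Sylow
  subgroup \<open>P\<close>; hence \<open>HP = KP\<close>. Consequently a subgroup between
  \<open>K\<close> and \<open>H\<close> that is invariant under \<open>P\<close> is normalized by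
  \<open>H\<close>.\<close>

lemma normal_section_subset_set_mult_sylow:
  assumes fin: "finite (carrier G)" and K: "K \<lhd> G" and H: "H \<lhd> G" "K \<subseteq> H"
    and card: "card H = p ^ k * card K"
    and p: "prime p" and P: "subgroup P G" "card P = p ^ multiplicity p (order G)"
  shows "H \<subseteq> K <#> P"
proof -
  have sK: "subgroup K G" and sH: "subgroup H G" using K H by (simp_all add: normal_imp_subgroup)
  have finX: "finite Y" if "subgroup Y G" for Y
    using subgroup.subset[OF that] fin by (rule finite_subset)
  have pos: "card Y > 0" if "subgroup Y G" for Y
    using card_subgroup_pos[OF that finX[OF that]] .
  have comm: "P <#> N = N <#> P" if "N \<lhd> G" for N
    using that subgroup.subset[OF P(1)] P(1)
    by (intro set_mult_commute_if_setnormalizer) (auto simp: normal_iff_setnormalizer)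
  have sV: "subgroup (K <#> P) G" using subgroup_set_mult[OF sK P(1)] comm[OF K] by simp
  have sU: "subgroup (H <#> P) G" using subgroup_set_mult[OF sH P(1)] comm[OF H(1)] by simp
  have VU: "K <#> P \<subseteq> H <#> P" using H(2) by (intro mono_set_mult) auto
  obtain d where d: "card (H <#> P) = card (K <#> P) * d"
    using card_subgroup_dvd[OF sV sU VU] by (auto simp: dvd_def)
  have "card (K <#> P) * (d * card (H \<inter> P)) = p ^ k * card K * card P"
    using card_set_mult[OF sH P(1) finX[OF sH] finX[OF P(1)]] d card by (simp add: mult.assoc)
  also have "\<dots> = card (K <#> P) * (p ^ k * card (K \<inter> P))"
    using card_set_mult[OF sK P(1) finX[OF sK] finX[OF P(1)]] by (simp add: ac_simps)
  finally have "d * card (H \<inter> P) = p ^ k * card (K \<inter> P)" using pos[OF sV] by simp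
  then have "d dvd p ^ k * card (K \<inter> P)" by (metis dvd_triv_left)
  also have "\<dots> dvd p ^ k * p ^ multiplicity p (order G)"
    using card_subgroup_dvd[OF subgroups_Inter_pair[OF sK P(1)] P(1)] P(2) by simp
  finally obtain i where i: "d = p ^ i" using p by (auto simp: divides_primepow_nat simp flip: power_add)
  have "i = 0"
  proof (rule ccontr)
    assume "i \<noteq> 0"
    then have "p dvd d" using i by auto
    then have "card P * p dvd card (K <#> P) * d"
      using card_subgroup_dvd[OF P(1) sV right_subset_set_mult[OF sK P(1)]] by (intro mult_dvd_mono)
    also have "\<dots> dvd order G"
      using card_subgroup_dvd[OF sU subgroup_self subgroup.subset[OF sU]] d by (simp add: order_def)
    finally have "p ^ Suc (multiplicity p (order G)) dvd order G" using P(2) by (simp add: mult.commute)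
    moreover have "order G \<noteq> 0" using fin order_gt_0_iff_finite by auto
    ultimately show False using p by (metis Suc_n_not_le_n multiplicity_geI not_prime_unit)
  qed
  then have "K <#> P = H <#> P" using d i VU finX[OF sU] by (intro card_subset_eq) auto
  then show "H \<subseteq> K <#> P" using left_subset_set_mult[OF sH P(1)] by simp
qed

text \<open>Induction on \<open>k\<close>, raising the bottom \<open>K\<close> by one factor
  \<open>p\<close> at a time. Each \<open>i\<close> receives its own subgroup and chain; terms for
  different \<open>i\<close> are not claimed to be nested.\<close>

lemma ex_setnormalized_chain:
  assumes p: "prime p" and H: "subgroup H G" "finite H"
    and P: "subgroup P G" "card P = p ^ m" "P \<subseteq> setnormalizer H"
    and K: "subgroup K G" "K \<subseteq> H" "P \<subseteq> setnormalizer K" "card H = p ^ k * card K"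
    and HKP: "H \<subseteq> K <#> P" and i: "i \<le> k"
  obtains A where "subgroup A G" "K \<subseteq> A" "A \<subseteq> H" "P \<subseteq> setnormalizer A"
    "card H = p ^ i * card A" "(H, A) \<in> maximal_rel ^^ i"
proof -
  have "\<exists>A. subgroup A G \<and> K \<subseteq> A \<and> A \<subseteq> H \<and> P \<subseteq> setnormalizer A \<and>
      card H = p ^ i * card A \<and> (H, A) \<in> maximal_rel ^^ i"
    using K HKP i
  proof (induction k arbitrary: K i)
    case 0
    then have "K = H" using H by (intro card_subset_eq) auto
    then show ?case using 0 by auto
  next
    case (Suc k)
    have finK: "finite K" using Suc.prems(2) H(2) by (rule finite_subset)
    \<comment> \<open>Both factors of \<open>KP\<close> normalize \<open>K\<close>, and
      \<open>H\<close> lies in \<open>KP\<close>.\<close>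
    have "H \<subseteq> setnormalizer K"
      using set_mult_subset_subgroup[OF setnormalizer_subgroup subgroup_subset_setnormalizer]
        Suc.prems(1,3,5) finK subgroup.subset by (meson order_trans)
    then obtain L where L: "subgroup L G" "K \<subseteq> L" "L \<subseteq> H" "P \<subseteq> setnormalizer L" "card L = p * card K"
      using ex_setnormalized_prime_index_above[OF p H(2) P(1,2) Suc.prems(3) P(3) Suc.prems(1) H(1)
          Suc.prems(2) _ Suc.prems(4)] by blast
    have cL: "card H = p ^ k * card L" using Suc.prems(4) L(5) by simp
    have HL: "H \<subseteq> L <#> P" using Suc.prems(5) L(2) mono_set_mult[of K L P P] by auto
    note IH = Suc.IH[OF L(1,3,4) cL HL]
    show ?case
    proof (cases "i \<le> k")
      case True
      then show ?thesis using IH L(2) by (meson order_trans)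
    next
      case False
      then have i: "i = Suc k" using Suc.prems(6) by simp
      obtain A where A: "L \<subseteq> A" "A \<subseteq> H" "card H = p ^ k * card A" "(H, A) \<in> maximal_rel ^^ k"
        using IH[of k] by auto
      \<comment> \<open>The term at depth \<open>k\<close> above \<open>L\<close> is
        \<open>L\<close> itself by cardinality, and \<open>K\<close> is one further maximal step
        down.\<close>
      have "card L = card A" using A(3) cL p by (simp add: prime_gt_0_nat)
      then have "L = A" using A(1,2) H(2) by (intro card_subset_eq) (auto intro: finite_subset)
      moreover have "(L, K) \<in> maximal_rel"
        using maximal_rel_prime_index[OF p L(1) _ Suc.prems(1) L(2,5)] L(3) H(2) finite_subset by blast
      ultimately have "(H, K) \<in> maximal_rel ^^ Suc k" using A(4) by auto
      then show ?thesis using Suc.prems i by auto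
    qed
  qed
  then show thesis using that by blast
qed

section \<open>Normality tested on Sylow subgroups, and orders of chief factors\<close>

lemma setnormalizer_eq_carrier:
  assumes fin: "finite (carrier G)" and A: "subgroup A G"
    and sylow: "\<And>p. prime (p::nat) \<Longrightarrow>
      \<exists>P. subgroup P G \<and> card P = p ^ multiplicity p (order G) \<and> P \<subseteq> setnormalizer A"
  shows "setnormalizer A = carrier G"
proof -
  have sN: "subgroup (setnormalizer A) G"
    using setnormalizer_subgroup subgroup.subset[OF A] fin finite_subset by blast
  have "card (setnormalizer A) > 0"
    using card_subgroup_pos[OF sN] subgroup.subset[OF sN] fin finite_subset by blast
  \<comment> \<open>For each prime, its full power in the group order divides the order of the
    normalizer.\<close>
  have "order G dvd card (setnormalizer A)"
  proof (rule multiplicity_le_imp_dvd)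
    show "order G \<noteq> 0" using fin order_gt_0_iff_finite by auto
    fix p :: nat assume p: "prime p"
    then obtain P where P: "subgroup P G" "card P = p ^ multiplicity p (order G)" "P \<subseteq> setnormalizer A"
      using sylow by blast
    have "p ^ multiplicity p (order G) dvd card (setnormalizer A)"
      using card_subgroup_dvd[OF P(1) sN P(3)] P(2) by simp
    then show "multiplicity p (order G) \<le> multiplicity p (card (setnormalizer A))"
      using \<open>card (setnormalizer A) > 0\<close> p by (intro multiplicity_geI) (auto simp: not_prime_unit)
  qed
  then have "card (carrier G) \<le> card (setnormalizer A)"
    using \<open>card (setnormalizer A) > 0\<close> by (intro dvd_imp_le) (simp_all add: order_def)
  then show ?thesis using subgroup.subset[OF sN] fin by (intro card_seteq)
qed

lemma ex_sylow:
  assumes "finite (carrier G)" "prime p"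
  obtains P where "subgroup P G" "card P = p ^ multiplicity p (order G)"
proof -
  have "order G = p ^ multiplicity p (order G) * (order G div p ^ multiplicity p (order G))"
    by (simp add: multiplicity_dvd)
  then show thesis using sylow_thm[OF assms(2) is_group _ assms(1)] that by blast
qed

lemma card_chief_factor:
  assumes "chief_factor G H K" "order (G\<lparr>carrier := H\<rparr> Mod K) = c"
  shows "card H = c * card K"
proof -
  have H: "subgroup H G" "subgroup K G" "K \<subseteq> H"
    using assms(1) by (auto simp: chief_factor_def normal_imp_subgroup)
  interpret H: group "G\<lparr>carrier := H\<rparr>" using H(1) by (rule subgroup_imp_group)
  have "card (rcosets\<^bsub>G\<lparr>carrier := H\<rparr>\<^esub> K) * card K = order (G\<lparr>carrier := H\<rparr>)"
    using H by (intro H.lagrange subgroup_incl)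
  then show ?thesis using assms(2) by (simp add: order_def FactGroup_def)
qed

section \<open>The bound on the exponent of a chief factor\<close>

lemma chief_factor_exponent_le:
  assumes fin: "finite (carrier G)" and n: "n > 1"
    and max: "\<And>X. n_maximal_subgroup n X G \<Longrightarrow> S_quasinormal X G"
    and p: "prime p" and chief: "chief_factor G H K"
    and ord: "order (G\<lparr>carrier := H\<rparr> Mod K) = p ^ k"
  shows "k \<le> n - 1"
proof (rule ccontr)
  assume "\<not> k \<le> n - 1"
  then have kn: "n \<le> k" by simp
  have nH: "H \<lhd> G" and nK: "K \<lhd> G" and KH: "K \<subset> H"
    and minimal: "\<And>N. N \<lhd> G \<Longrightarrow> K \<subseteq> N \<Longrightarrow> N \<subseteq> H \<Longrightarrow> N = K \<or> N = H"
    using chief by (auto simp: chief_factor_def)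
  have sH: "subgroup H G" and sK: "subgroup K G" using nH nK by (simp_all add: normal_imp_subgroup)
  have card: "card H = p ^ k * card K" using card_chief_factor[OF chief ord] .
  have finX: "finite Y" if "subgroup Y G" for Y
    using subgroup.subset[OF that] fin by (rule finite_subset)
  have pos: "card Y > 0" if "subgroup Y G" for Y
    using card_subgroup_pos[OF that finX[OF that]] .
  have p1: "p > 1" using p by (rule prime_gt_1_nat)
  have max': "S_quasinormal X G" if "(carrier G, X) \<in> maximal_rel ^^ n" for X
    using that max by (simp add: n_maximal_subgroup_iff)
  obtain P where P: "subgroup P G" "card P = p ^ multiplicity p (order G)"
    using ex_sylow[OF fin p] .
  have PN: "P \<subseteq> setnormalizer N" if "N \<lhd> G" for N
    using that subgroup.subset[OF P(1)] by (simp add: normal_iff_setnormalizer)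
  obtain A where A: "\<And>i. i \<le> k \<Longrightarrow> subgroup (A i) G \<and> K \<subseteq> A i \<and> A i \<subseteq> H \<and> P \<subseteq> setnormalizer (A i) \<and>
      card H = p ^ i * card (A i) \<and> (H, A i) \<in> maximal_rel ^^ i"
  proof -
    have "\<forall>i. \<exists>A. i \<le> k \<longrightarrow> subgroup A G \<and> K \<subseteq> A \<and> A \<subseteq> H \<and> P \<subseteq> setnormalizer A \<and>
      card H = p ^ i * card A \<and> (H, A) \<in> maximal_rel ^^ i"
    proof
      fix i
      show "\<exists>A. i \<le> k \<longrightarrow> subgroup A G \<and> K \<subseteq> A \<and> A \<subseteq> H \<and> P \<subseteq> setnormalizer A \<and>
        card H = p ^ i * card A \<and> (H, A) \<in> maximal_rel ^^ i"
      proof (cases "i \<le> k")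
        case True
        then show ?thesis
          using ex_setnormalized_chain[OF p sH finX[OF sH] P PN[OF nH] sK _ PN[OF nK] card
              normal_section_subset_set_mult_sylow[OF fin nK nH _ card p P], of i] KH
          by (metis psubset_imp_subset)
      qed auto
    qed
    then show thesis using that by metis
  qed
  \<comment> \<open>Together with \<open>P\<close>, such Sylow subgroups would make
    \<open>A i\<close> normal in the whole group, although its order puts it strictly between
    \<open>K\<close> and \<open>H\<close>.\<close>
  have final: False
    if i: "0 < i" "i < k"
      and sylow: "\<And>r R. prime r \<Longrightarrow> r \<noteq> p \<Longrightarrow> subgroup R G \<Longrightarrow>
        card R = r ^ multiplicity r (order G) \<Longrightarrow> R \<subseteq> setnormalizer (A i)" for i
  proof -
    note Ai = A[OF less_imp_le[OF i(2)]]
    have "setnormalizer (A i) = carrier G"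
    proof (rule setnormalizer_eq_carrier[OF fin])
      fix r :: nat assume r: "prime r"
      show "\<exists>R. subgroup R G \<and> card R = r ^ multiplicity r (order G) \<and> R \<subseteq> setnormalizer (A i)"
      proof (cases "r = p")
        case True
        then show ?thesis using P Ai by blast
      next
        case False
        obtain R where "subgroup R G" "card R = r ^ multiplicity r (order G)" using ex_sylow[OF fin r] .
        then show ?thesis using sylow r False by blast
      qed
    qed (use Ai in blast)
    then have "A i = K \<or> A i = H" using Ai by (intro minimal) (auto simp: normal_iff_setnormalizer)
    moreover have "A i \<noteq> H"
    proof
      assume "A i = H"
      then have "p ^ i = 1" using Ai pos[OF sH] by auto
      then show False using p1 i(1) by simp
    qed
    moreover have "A i \<noteq> K"
    proof
      assume "A i = K"
      then have "p ^ i = p ^ k" using Ai card pos[OF sK] by auto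
      then show False using i p1 by simp
    qed
    ultimately show False by blast
  qed
  have S_final: False if X: "S_quasinormal X G" "X \<inter> H = A i" and i: "0 < i" "i < k" for X i
  proof (rule final[OF i])
    fix r R assume r: "prime (r::nat)" "r \<noteq> p" and R: "subgroup R G" "card R = r ^ multiplicity r (order G)"
    have "sylow_subgroup R G" using r R by (auto simp: sylow_subgroup_def)
    moreover have "K \<subseteq> X \<inter> H" using X(2) A[of i] i by auto
    ultimately have "R \<subseteq> setnormalizer (X \<inter> H)"
      using sylow_setnormalizes_Int[OF fin X(1) nH sK _ card p r(1) r(2)[symmetric]] R(2) by blast
    then show "R \<subseteq> setnormalizer (A i)" using X(2) by simp
  qed
  \<comment> \<open>The commutator outside \<open>K\<close> witnesses a nontrivial action of
    \<open>Q\<close> on \<open>H/K\<close>. If all such commutators lay in \<open>K\<close>, then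
    \<open>A 1\<close> would contradict \<open>final\<close>; note that 1 < \<open>n\<close> \<le>
    \<open>k\<close>.\<close>
  obtain q Q h g where q: "prime q" "q \<noteq> p" and Q: "subgroup Q G" "card Q = q ^ multiplicity q (order G)"
    and gh: "h \<in> H" "g \<in> Q" "g \<otimes> h \<otimes> inv g \<otimes> inv h \<notin> K"
  proof (rule ccontr)
    note found = that
    assume "\<not> thesis"
    then have triv: "g \<otimes> h \<otimes> inv g \<otimes> inv h \<in> K" if "prime q" "q \<noteq> p" "subgroup Q G"
      "card Q = q ^ multiplicity q (order G)" "h \<in> H" "g \<in> Q" for q Q h g
      using that found by blast
    show False
    proof (rule final[of 1])
      fix r R assume r: "prime (r::nat)" "r \<noteq> p" and R: "subgroup R G" "card R = r ^ multiplicity r (order G)"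
      have A1: "subgroup (A 1) G" "K \<subseteq> A 1" "A 1 \<subseteq> H" using A[of 1] kn n by auto
      have "g \<otimes> a \<otimes> inv g \<in> A 1" if "g \<in> R" "a \<in> A 1" for g a
      proof -
        have c: "g \<in> carrier G" "a \<in> carrier G"
          using that subgroup.mem_carrier[OF R(1)] subgroup.mem_carrier[OF A1(1)] by auto
        have "g \<otimes> a \<otimes> inv g \<otimes> inv a \<in> A 1" using triv[OF r R] that A1 by blast
        then have "g \<otimes> a \<otimes> inv g \<otimes> inv a \<otimes> a \<in> A 1"
          using that(2) by (rule subgroup.m_closed[OF A1(1)])
        then show ?thesis using c by (simp add: m_assoc)
      qed
      then show "R \<subseteq> setnormalizer (A 1)"
        using subgroup.mem_carrier[OF R(1)] by (auto simp: setnormalizer_def)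
    qed (use kn n in auto)
  qed
  have HQK: "H \<inter> Q \<subseteq> K"
    using normal_section_Int_subset[OF fin nK sH _ card p q(1) q(2)[symmetric] Q] KH by blast
  have gG: "g \<in> carrier G" "h \<in> carrier G"
    using gh subgroup.mem_carrier[OF Q(1)] subgroup.mem_carrier[OF sH] by auto
  have comm_H: "g \<otimes> h \<otimes> inv g \<otimes> inv h \<in> H"
    using nH gh gG by (auto simp: normal_inv_iff subgroup.m_closed subgroup.m_inv_closed)
  have syl: "sylow_subgroup Q G" using q Q by (auto simp: sylow_subgroup_def)
  have "Q <#> H = H <#> Q"
    using nH subgroup.subset[OF Q(1)] Q(1) sH
    by (intro set_mult_commute_if_setnormalizer) (auto simp: normal_iff_setnormalizer)
  then have sHQ: "subgroup (H <#> Q) G" using subgroup_set_mult[OF sH Q(1)] by simp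
  have HHQ: "H \<subseteq> H <#> Q" "Q \<subseteq> H <#> Q"
    using left_subset_set_mult[OF sH Q(1)] right_subset_set_mult[OF sH Q(1)] by auto
  obtain c where c: "(carrier G, H <#> Q) \<in> maximal_rel ^^ c"
    using ex_maximal_relpow[OF fin subgroup_self sHQ subgroup.subset[OF sHQ]] .
  obtain a where a: "(H <#> Q, H) \<in> maximal_rel ^^ a"
    using ex_maximal_relpow[OF finX[OF sHQ] sHQ sH HHQ(1)] .
  \<comment> \<open>If \<open>a\<close> were 0, then \<open>Q\<close> would lie in \<open>H\<close>,
    hence in \<open>K\<close>, and so would the chosen commutator. Positivity of \<open>a\<close>
    later keeps \<open>n - (c + a)\<close> below \<open>k\<close>.\<close>
  have "a \<noteq> 0"
  proof
    assume "a = 0"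
    then have "Q \<subseteq> K" using a HHQ HQK by auto
    then have "g \<in> K" using gh by auto
    then have "g \<otimes> (h \<otimes> inv g \<otimes> inv h) \<in> K"
      using nK gG by (auto simp: normal_inv_iff subgroup.m_closed subgroup.m_inv_closed)
    then show False using gh gG by (simp add: m_assoc)
  qed
  show False
  proof (cases "c + a \<le> n - 1")
    case True
    \<comment> \<open>The steps left after reaching \<open>H\<close>: at least one by the case
      assumption, and fewer than \<open>n\<close> because \<open>a\<close> is positive, so
      \<open>A i\<close> is a proper intermediate term.\<close>
    define i where "i = n - (c + a)"
    have i: "0 < i" "i < k" "n = (c + a) + i" using True \<open>a \<noteq> 0\<close> kn n by (auto simp: i_def)
    have "(carrier G, A i) \<in> maximal_rel ^^ n"
      unfolding i(3) relpow_add[of "c + a"] relpow_add[of c] using c a A[of i] i(2) by auto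
    then have "S_quasinormal (A i) G" by (rule max')
    moreover have "A i \<inter> H = A i" using A[of i] i by auto
    ultimately show False using S_final i by blast
  next
    case False
    have A1: "subgroup (A 1) G" "K \<subseteq> A 1" "A 1 \<subseteq> H" "card H = p * card (A 1)"
      using A[of 1] kn n by auto
    obtain W where W: "(carrier G, W) \<in> maximal_rel ^^ (n - 1)" "H \<subseteq> W"
      "Q \<subseteq> W \<or> W \<subseteq> H <#> Q"
    proof (cases "n - 1 \<le> c")
      case True
      then obtain j where "c = (n - 1) + j" using le_Suc_ex by blast
      then obtain W where W: "(carrier G, W) \<in> maximal_rel ^^ (n - 1)" "(W, H <#> Q) \<in> maximal_rel ^^ j"
        using c by (auto simp: relpow_add)
      have "subgroup W G" using maximal_relpow_subgroup[OF subgroup_self W(1)] by simp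
      then have "H <#> Q \<subseteq> W" using maximal_relpow_subgroup[OF _ W(2)] by simp
      then show thesis using that W(1) HHQ by blast
    next
      case c': False
      \<comment> \<open>Here \<open>c\<close> < \<open>n - 1\<close> < \<open>c + a\<close>, so the
        chain is cut \<open>j\<close> steps below \<open>HQ\<close>, at or above
        \<open>H\<close>.\<close>
      define j where "j = n - 1 - c"
      have "n - 1 = c + j" "a = j + (a - j)" using False c' by (auto simp: j_def)
      then obtain W where W: "(H <#> Q, W) \<in> maximal_rel ^^ j" "(W, H) \<in> maximal_rel ^^ (a - j)"
        using a relpow_add by (metis relcompE prod.inject)
      have "(carrier G, W) \<in> maximal_rel ^^ (n - 1)"
        unfolding \<open>n - 1 = c + j\<close> relpow_add using c W by auto
      moreover have "subgroup W G" "W \<subseteq> H <#> Q" using maximal_relpow_subgroup[OF sHQ W(1)] by auto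
      ultimately show thesis using that maximal_relpow_subgroup[OF _ W(2)] by blast
    qed
    have sW: "subgroup W G" using maximal_relpow_subgroup[OF subgroup_self W(1)] by simp
    \<comment> \<open>In either position of \<open>W\<close> the product \<open>WQ\<close> is a
      subgroup, as the Frattini argument requires.\<close>
    have WQ: "W <#> Q = W \<or> W <#> Q = H <#> Q"
      using W(3)
    proof
      assume "Q \<subseteq> W"
      then have "W <#> Q = W"
        using set_mult_subset_subgroup[OF sW, of W Q] left_subset_set_mult[OF sW Q(1)] by auto
      then show ?thesis ..
    next
      assume "W \<subseteq> H <#> Q"
      then have "W <#> Q = H <#> Q"
        using set_mult_subset_subgroup[OF sHQ, of W Q] HHQ(2) mono_set_mult[OF W(2) order_refl[of Q], of G] by auto
      then show ?thesis ..
    qed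
    have max_W: "S_quasinormal X G" if "(W, X) \<in> maximal_rel" for X
      using max'[of X] W(1) that n relpow_Suc_I[of "carrier G" W "n - 1" maximal_rel X] by simp
    have norm: "W \<subseteq> setnormalizer (Q \<inter> W)"
      using sylow_Int_setnormalized[OF fin sW syl q(1) Q(2) _ max_W] WQ sW sHQ by auto
    show False
    proof (cases "Q \<subseteq> W")
      case True
      \<comment> \<open>Here \<open>Q\<close> is normal in \<open>W\<close>, which contains
        \<open>h\<close>, so the commutator falls into \<open>H \<inter> Q\<close>, hence into
        \<open>K\<close>.\<close>
      then have "h \<otimes> inv g \<otimes> inv h \<in> Q"
        using norm W(2) gh subgroup.m_inv_closed[OF Q(1)] by (auto simp: setnormalizer_def Int_absorb2)
      then have "g \<otimes> (h \<otimes> inv g \<otimes> inv h) \<in> Q" using gh subgroup.m_closed[OF Q(1)] by blast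
      then have "g \<otimes> h \<otimes> inv g \<otimes> inv h \<in> H \<inter> Q" using comm_H gG by (simp add: m_assoc)
      then show False using HQK gh by blast
    next
      case False
      then have WHQ: "W \<subseteq> H <#> Q" using W(3) by blast
      define S where "S = Q \<inter> W"
      have sS: "subgroup S G" using Q sW by (simp add: S_def subgroups_Inter_pair)
      \<comment> \<open>Replacing the factor \<open>H\<close> of \<open>W\<close> by
        \<open>A 1\<close> lowers the order by exactly \<open>p\<close>. The trace on
        \<open>H\<close> is still \<open>A 1\<close>, since \<open>H \<inter> S\<close> lies in
        \<open>K\<close>.\<close>
      define X where "X = A 1 <#> S"
      have sX: "subgroup X G" unfolding X_def
        using norm A1 W(2) sS by (intro subgroup_set_mult set_mult_commute_if_setnormalizer) (auto simp: S_def)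
      have XH: "X \<inter> H = A 1"
      proof
        show "A 1 \<subseteq> X \<inter> H" using left_subset_set_mult[OF A1(1) sS] A1 by (simp add: X_def)
        show "X \<inter> H \<subseteq> A 1"
        proof
          fix x assume x: "x \<in> X \<inter> H"
          then obtain b s where bs: "b \<in> A 1" "s \<in> S" "x = b \<otimes> s" by (auto simp: X_def set_mult_iff)
          then have "s = inv b \<otimes> x"
            using subgroup.mem_carrier[OF A1(1)] subgroup.mem_carrier[OF sS] by simp
          also have "\<dots> \<in> H"
            using x bs(1) A1(3) subgroup.m_closed[OF sH] subgroup.m_inv_closed[OF sH] by blast
          finally have "s \<in> H" .
          then have "s \<in> A 1" using bs HQK A1 by (auto simp: S_def)
          then show "x \<in> A 1" using bs subgroup.m_closed[OF A1(1)] by simp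
        qed
      qed
      \<comment> \<open>Dedekind's law for \<open>H\<close> inside \<open>W\<close> inside
        \<open>HQ\<close>.\<close>
      have W_eq: "W = H <#> S"
      proof
        show "H <#> S \<subseteq> W" using W(2) by (intro set_mult_subset_subgroup[OF sW]) (auto simp: S_def)
        show "W \<subseteq> H <#> S"
        proof
          fix w assume w: "w \<in> W"
          then have "w \<in> H <#> Q" using WHQ by blast
          then obtain b s where bs: "b \<in> H" "s \<in> Q" "w = b \<otimes> s" by (auto simp: set_mult_iff)
          then have "s = inv b \<otimes> w"
            using subgroup.mem_carrier[OF sH] subgroup.mem_carrier[OF Q(1)] by simp
          also have "\<dots> \<in> W"
            using w bs(1) W(2) subgroup.m_closed[OF sW] subgroup.m_inv_closed[OF sW] by blast
          finally have "s \<in> W" .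
          then show "w \<in> H <#> S" using bs by (auto simp: S_def set_mult_iff)
        qed
      qed
      \<comment> \<open>Equal intersections cancel in the two product formulas, so the index of
        \<open>X\<close> in \<open>W\<close> is that of \<open>A 1\<close> in \<open>H\<close>,
        namely \<open>p\<close>.\<close>
      have "H \<inter> S = A 1 \<inter> S" using HQK A1 by (auto simp: S_def)
      then have "card W * card (A 1 \<inter> S) = p * card (A 1) * card S"
        using card_set_mult[OF sH sS finX[OF sH] finX[OF sS]] A1(4) by (simp add: W_eq[symmetric])
      also have "\<dots> = p * (card X * card (A 1 \<inter> S))"
        using card_set_mult[OF A1(1) sS finX[OF A1(1)] finX[OF sS]] by (simp add: X_def)
      finally have "card W = p * card X"
        using pos[OF subgroups_Inter_pair[OF A1(1) sS]] by simp
      moreover have "X \<subseteq> W" unfolding X_def W_eq using A1 by (intro mono_set_mult) auto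
      ultimately have "(W, X) \<in> maximal_rel"
        using maximal_rel_prime_index[OF p sW finX[OF sW] sX] by blast
      then have "S_quasinormal X G" by (rule max_W)
      then show False using S_final XH kn n by (metis less_le_trans zero_less_one)
    qed
  qed
qed

end

theorem corollary1p3:
  fixes G :: "('a, 'b) monoid_scheme" and n :: nat
  assumes "group G" and "finite (carrier G)" and "solvable G"
    and "n > 1"
    and "\<And>H. n_maximal_subgroup n H G \<Longrightarrow> S_quasinormal H G"
  shows "chief_rank G \<le> n - 1"
proof -
  let ?S = "{k. \<exists>p H K. prime (p::nat) \<and> chief_factor G H K \<and> order (G\<lparr>carrier := H\<rparr> Mod K) = p ^ k}"
  have bound: "k \<le> n - 1" if "k \<in> ?S" for k
    using that group.chief_factor_exponent_le[OF assms(1,2,4,5)] by blast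
  have "Sup ?S \<le> n - 1"
  \<comment> \<open>\<open>cSup_least\<close> needs a nonempty set; for the empty one
    \<open>Sup\<close> on \<open>nat\<close> is 0.\<close>
  proof (cases "?S = {}")
    case True
    show ?thesis unfolding True by (simp add: Sup_nat_empty)
  next
    case False
    then show ?thesis by (rule cSup_least) (rule bound)
  qed
  then show ?thesis by (simp add: chief_rank_def)
qed

end
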